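(* Let $1<k\in\mathbb{Z}$ and $n=2k+1$. The lexical coloring yields a 1-factorization of $M_k/\pi$ by the colors $0,1,\ldots,k$, which can be lifted to a covering 1-factorization of $M_k$ and subsequently collapsed onto a folding 1-factorization of $R_k$. This ensures the notation $\delta(v)$ for each vertex $v$ of $R_k$, so that there is a unique $k$-germ $\alpha=\alpha(v)$ with $\langle F(\alpha)\rangle=\delta(v)$.
   Context: Graphs. $M_k$ is the graph whose vertices are the binary $n$-strings (coordinates indexed by $\mathbb{Z}_n$) of weight $k$ (set $L_k$) or $k+1$ (set $L_{k+1}$), two being adjacent iff they differ in exactly one entry. $M_k/\pi$ is its quotient (multi)graph under cyclic translation of coordinates: vertices and edges are translation classes of vertices and edges of $M_k$; $L_k/\pi$, $L_{k+1}/\pi$ are the two vertex parts. The complemented reversal $\aleph(b_0\cdots b_{2k})=\bar b_{2k}\cdots\bar b_0$ induces an involution $\aleph_\pi$ of $M_k/\pi$. An edge of $M_k/\pi$ is horizontal if it joins some $v$ to $\aleph_\pi(v)$, and skew otherwise. $R_k$ is the graph with loops whose vertices are the pairs $\{v,\aleph_\pi(v)\}$, $v\in L_k/\pi$, with one edge for each pair of skew edges of $M_k/\pi$ exchanged by $\aleph_\pi$ and one loop for each horizontal edge of $M_k/\pi$. A 1-factorization by colors $0,\ldots,k$ is a coloring of the edges (and loops) such that each vertex is incident to exactly one edge (or loop, a loop counting once) of each color. "Lifted to $M_k$" means each edge of $M_k$ gets the color of its class; "collapsed onto $R_k$" means each edge or loop of $R_k$ gets the common color of the edges of $M_k/\pi$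 it comes from. Lexical coloring. For $b\in L_k$ put $S=\{i:b_i=1\}$, $S^c=\mathbb{Z}_n\setminus S$, and $[y,x)=\{y,y+1,\ldots,x-1\}$ (mod $n$). The edge of $M_k$ joining $b$ to the string obtained by changing $b_x=0$ to $1$ ($x\in S^c$) has color $|\{y\in S^c\setminus\{x\}: |[y,x)\cap S|<|[y,x)\cap S^c|\}|$. This is translation invariant, hence defines colors on the edges of $M_k/\pi$. (Equivalently, translate so that $x=0$; trace in the grid $\{0,\ldots,k\}^2$ the lattice path from $(0,0)$ to $(k,k)$ determined by the entries of the string, a unit step $(1,0)$ for each $0$ and $(0,1)$ for each $1$, and count horizontal steps on the appropriate side of the diagonal.) $\delta(v)$. For $v\in L_k/\pi$ (representing the vertex $\{v,\aleph_\pi(v)\}$ of $R_k$), label each $0$-entry of a representative by the color of the edge obtained by changing it to $1$ and each $1$-entry by $*$; $\delta(v)$ is the resulting cyclic $n$-string of labels written starting at the label $0$. $\langle\cdot\rangle$ denotes the class of a string of labels, written starting at the entry $0$. $k$-germs and $F$. A $k$-germ is a $(k-1)$-string $\alpha=a_{k-1}\cdots a_1$ of nonnegative integers with $a_{k-1}\in\{0,1\}$ and $0\le a_{i-1}\le a_i+1$ for $1<i<k$. For $\alpha\ne0^{k-1}$ with rightmost nonzero entry $a_i$, $\beta(\alpha)$ is obtained from $\alpha$ by replacing $a_i$ by $a_i-1$. $F(0^{k-1})=01\cdots k*\cdots*$ ($k$ asterisks); if $\alpha\ne 0^{k-1}$ has rightmost nonzero entry $a_i$, write $F(\beta(\alpha))=W|X|Y|Z$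 with $W,Z$ its initial and terminal substrings of length $i$, $\Omega$ the first entry of $X$, and $Y$ starting at the entry $\Omega+1$; then $F(\alpha)=W|Y|X|Z$. *)

theory Defs
  imports Main
begin

section \<open>Multigraphs with loops and 1-factorizations\<close>

text \<open>\<open>ends G e\<close> is the set of the one (for a loop) or two end vertices of the edge \<open>e\<close>.\<close>

record ('v, 'e) multigraph =
  verts :: "'v set"
  edges :: "'e set"
  ends :: "'e \<Rightarrow> 'v set"

definition one_factorization :: "('v, 'e) multigraph \<Rightarrow> nat set \<Rightarrow> ('e \<Rightarrow> nat) \<Rightarrow> bool" where
  "one_factorization G C c \<longleftrightarrow>
     (\<forall>e\<in>edges G. c e \<in> C) \<and>
     (\<forall>v\<in>verts G. \<forall>i\<in>C. \<exists>!e. e \<in> edges G \<and> v \<in> ends G e \<and> c e = i)"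

definition common_value :: "('a \<Rightarrow> 'b) \<Rightarrow> 'a set \<Rightarrow> 'b" where
  "common_value f A = (THE c. \<forall>x\<in>A. f x = c)"


section \<open>The graphs \<open>M\<^sub>k\<close>, \<open>M\<^sub>k/\<pi>\<close> and \<open>R\<^sub>k\<close>\<close>

text \<open>A binary \<open>n\<close>-string is a Boolean list of length \<open>n = 2k+1\<close>, with \<open>True\<close> for the entry 1.\<close>

type_synonym bstring = "bool list"

definition level :: "nat \<Rightarrow> nat \<Rightarrow> bstring set" where
  "level k w = {b. length b = 2 * k + 1 \<and> count_list b True = w}"

definition middle_graph :: "nat \<Rightarrow> (bstring, bstring set) multigraph" where
  "middle_graph k =
    \<lparr> verts = level k k \<union> level k (k + 1),
      edges = {{b, c} | b c. b \<in> level k k \<union> level k (k + 1) \<and> c \<in> level k k \<union> level k (k + 1) \<and>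
                 card {i. i < 2 * k + 1 \<and> b ! i \<noteq> c ! i} = 1},
      ends = (\<lambda>e. e) \<rparr>"

definition vertex_class :: "bstring \<Rightarrow> bstring set" where
  "vertex_class b = range (\<lambda>j. rotate j b)"

definition edge_class :: "bstring set \<Rightarrow> bstring set set" where
  "edge_class e = range (\<lambda>j. rotate j ` e)"

definition quotient_graph :: "nat \<Rightarrow> (bstring set, bstring set set) multigraph" where
  "quotient_graph k =
    \<lparr> verts = vertex_class ` verts (middle_graph k),
      edges = edge_class ` edges (middle_graph k),
      ends = (\<lambda>E. \<Union>e\<in>E. vertex_class ` ends (middle_graph k) e) \<rparr>"

definition aleph :: "bstring \<Rightarrow> bstring" where
  "aleph b = map Not (rev b)"

definition aleph_vertex :: "bstring set \<Rightarrow> bstring set" where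
  "aleph_vertex v = aleph ` v"

definition aleph_edge :: "bstring set set \<Rightarrow> bstring set set" where
  "aleph_edge E = (\<lambda>e. aleph ` e) ` E"

definition horizontal :: "nat \<Rightarrow> bstring set set \<Rightarrow> bool" where
  "horizontal k E \<longleftrightarrow> E \<in> edges (quotient_graph k) \<and>
     (\<exists>v\<in>verts (quotient_graph k). ends (quotient_graph k) E = {v, aleph_vertex v})"

definition skew :: "nat \<Rightarrow> bstring set set \<Rightarrow> bool" where
  "skew k E \<longleftrightarrow> E \<in> edges (quotient_graph k) \<and> \<not> horizontal k E"

definition vertex_pair :: "bstring set \<Rightarrow> bstring set set" where
  "vertex_pair v = {v, aleph_vertex v}"

text \<open>An edge of \<open>R\<^sub>k\<close> is represented by the set of the edges of \<open>M\<^sub>k/\<pi>\<close> it comes from: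
  a pair of skew edges, or a single horizontal edge in the case of a loop.\<close>

definition folded_graph :: "nat \<Rightarrow> (bstring set set, bstring set set set) multigraph" where
  "folded_graph k =
    \<lparr> verts = vertex_pair ` vertex_class ` level k k,
      edges = {{E, aleph_edge E} | E. skew k E} \<union> {{E} | E. horizontal k E},
      ends = (\<lambda>Q. \<Union>E\<in>Q. vertex_pair ` ends (quotient_graph k) E) \<rparr>"


section \<open>The lexical coloring and the label strings \<open>\<delta>(v)\<close>\<close>

text \<open>The cyclic interval \<open>[y, x)\<close> of \<open>\<int>\<^sub>n\<close>, for \<open>x, y < n\<close>.\<close>

definition cyclic_interval :: "nat \<Rightarrow> nat \<Rightarrow> nat \<Rightarrow> nat set" where
  "cyclic_interval n y x = {(y + t) mod n | t. t < (x + n - y) mod n}"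

definition lexical_color :: "bstring \<Rightarrow> nat \<Rightarrow> nat" where
  "lexical_color b x =
    (let n = length b; S = {i. i < n \<and> b ! i}; S' = {i. i < n \<and> \<not> b ! i} in
     card {y \<in> S' - {x}.
       card (cyclic_interval n y x \<inter> S) < card (cyclic_interval n y x \<inter> S')})"

text \<open>The lower end \<open>b\<close> of an edge of \<open>M\<^sub>k\<close> and the position \<open>x\<close> are determined by the edge.\<close>

definition lexical_edge_color :: "nat \<Rightarrow> bstring set \<Rightarrow> nat" where
  "lexical_edge_color k e =
    (THE c. \<exists>b x. b \<in> level k k \<and> x < 2 * k + 1 \<and> \<not> b ! x \<and> e = {b, b[x := True]} \<and>
       c = lexical_color b x)"

definition quotient_color :: "nat \<Rightarrow> bstring set set \<Rightarrow> nat" where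
  "quotient_color k E = common_value (lexical_edge_color k) E"

definition lifted_color :: "nat \<Rightarrow> bstring set \<Rightarrow> nat" where
  "lifted_color k e = quotient_color k (edge_class e)"

definition collapsed_color :: "nat \<Rightarrow> bstring set set set \<Rightarrow> nat" where
  "collapsed_color k Q = common_value (quotient_color k) Q"

text \<open>In label strings, \<open>None\<close> stands for the asterisk. A cyclic string of labels that contains
  the label 0 exactly once is represented by its unique rotation that starts with 0.\<close>

type_synonym lstring = "nat option list"

definition from_zero :: "lstring \<Rightarrow> lstring" where
  "from_zero s = dropWhile (\<lambda>a. a \<noteq> Some 0) s @ takeWhile (\<lambda>a. a \<noteq> Some 0) s"

definition labels :: "nat \<Rightarrow> bstring \<Rightarrow> lstring" where
  "labels k b =
    map (\<lambda>i. if b ! i then None else Some (lexical_edge_color k {b, b[i := True]})) [0..<2 * k + 1]"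

text \<open>For the vertex \<open>V = {v, \<aleph>\<^sub>\<pi>(v)}\<close> of \<open>R\<^sub>k\<close> with \<open>v \<in> L\<^sub>k/\<pi>\<close>, the set \<open>\<Union>V \<inter> level k k\<close>
  consists of the representatives of \<open>v\<close>.\<close>

definition delta :: "nat \<Rightarrow> bstring set set \<Rightarrow> lstring" where
  "delta k V = common_value (\<lambda>b. from_zero (labels k b)) (\<Union>V \<inter> level k k)"


section \<open>\<open>k\<close>-germs and the map \<open>F\<close>\<close>

text \<open>The string \<open>a\<^bsub>k-1\<^esub> \<dots> a\<^sub>1\<close> is a list written from left to right, so that \<open>entry \<alpha> i\<close> is \<open>a\<^sub>i\<close>
  for \<open>1 \<le> i \<le> k - 1 = length \<alpha>\<close>.\<close>

definition entry :: "nat list \<Rightarrow> nat \<Rightarrow> nat" where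
  "entry \<alpha> i = \<alpha> ! (length \<alpha> - i)"

definition germ :: "nat \<Rightarrow> nat list \<Rightarrow> bool" where
  "germ k \<alpha> \<longleftrightarrow> length \<alpha> = k - 1 \<and> entry \<alpha> (k - 1) \<in> {0, 1} \<and>
     (\<forall>i. 1 < i \<and> i < k \<longrightarrow> entry \<alpha> (i - 1) \<le> entry \<alpha> i + 1)"

definition rightmost_nonzero :: "nat list \<Rightarrow> nat" where
  "rightmost_nonzero \<alpha> = (LEAST i. 1 \<le> i \<and> i \<le> length \<alpha> \<and> entry \<alpha> i \<noteq> 0)"

definition beta :: "nat list \<Rightarrow> nat list" where
  "beta \<alpha> = (let i = rightmost_nonzero \<alpha> in \<alpha>[length \<alpha> - i := entry \<alpha> i - 1])"

lemma sum_list_beta_less: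
  assumes "\<not> (\<forall>a\<in>set \<alpha>. a = 0)"
  shows "sum_list (beta \<alpha>) < sum_list \<alpha>"
proof -
  obtain j where j: "j < length \<alpha>" "\<alpha> ! j \<noteq> 0"
    using assms by (auto simp: in_set_conv_nth)
  then have "1 \<le> length \<alpha> - j \<and> length \<alpha> - j \<le> length \<alpha> \<and> entry \<alpha> (length \<alpha> - j) \<noteq> 0"
    by (auto simp: entry_def)
  then have i: "1 \<le> rightmost_nonzero \<alpha> \<and> rightmost_nonzero \<alpha> \<le> length \<alpha>
      \<and> entry \<alpha> (rightmost_nonzero \<alpha>) \<noteq> 0"
    unfolding rightmost_nonzero_def by (rule LeastI)
  then have l: "length \<alpha> - rightmost_nonzero \<alpha> < length \<alpha>" by linarith
  have "\<alpha> ! (length \<alpha> - rightmost_nonzero \<alpha>) \<le> sum_list \<alpha>"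
    using l by (rule elem_le_sum_list)
  then show ?thesis
    using i l by (simp add: beta_def Let_def entry_def sum_list_update)
qed

text \<open>\<open>Y\<close> starts at the (first) entry \<open>\<Omega> + 1\<close> of the middle part \<open>X|Y\<close>, where \<open>\<Omega>\<close> is the first entry
  of that part; for germs \<open>\<Omega>\<close> is a number and \<open>\<Omega> + 1\<close> does occur. Other lists get a junk value.\<close>

function germ_string :: "nat list \<Rightarrow> lstring" where
  "germ_string \<alpha> =
    (let k = length \<alpha> + 1 in
     if \<forall>a\<in>set \<alpha>. a = 0 then map Some [0..<k + 1] @ replicate k None
     else
       (let i = rightmost_nonzero \<alpha>;
            s = germ_string (beta \<alpha>);
            W = take i s;
            Z = drop (length s - i) s;
            XY = drop i (take (length s - i) s);
            \<Omega> = hd XY;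
            X = takeWhile (\<lambda>a. a \<noteq> map_option Suc \<Omega>) XY;
            Y = dropWhile (\<lambda>a. a \<noteq> map_option Suc \<Omega>) XY
        in W @ Y @ X @ Z))"
  by pat_completeness auto
termination
  by (relation "measure sum_list") (auto simp del: sum_list_eq_0_iff intro: sum_list_beta_less)

declare germ_string.simps [simp del]

end

theory Submission
  imports Defs
begin

text \<open>Read a string as a path that climbs at each 0 and descends at each 1. For a string with \<open>k + 1\<close>
  zeros the lexical color of a zero is its rank among the zeros, ordered by increasing height and,
  at equal height, by decreasing position; so every color occurs exactly once at a vertex of \<open>L\<^sub>k\<close>.
  In terms of the closed path that follows the zero around the cycle, the color counts the up-steps
  below the starting level. There are equally many down-steps below this level, so complemented
  reversal preserves colors, which settles \<open>L\<^bsub>k+1\<^esub>\<close> and the folding.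

  For the label strings: rotating a string so that the label 0 comes first turns it into \<open>0 u 1\<close>,
  where \<open>u\<close> has one more 0 than 1 and all heights of prefixes of \<open>u\<close> are nonnegative; the labels
  of \<open>u\<close> in \<open>0 u 1\<close> are its own labels increased by 1. Conversely a rotation of \<open>0 u 1\<close> has
  nonnegative prefix heights iff its first label is at most 1 plus the first label of \<open>u\<close>, which
  is exactly the condition relating consecutive entries of a germ. Each step \<open>W|X|Y|Z \<mapsto> W|Y|X|Z\<close> in the
  construction of \<open>F\<close> rotates the middle part to its next larger first label; hence \<open>F\<close> builds the
  label string by iterating "wrap, then rotate to the label \<open>a\<^sub>i\<close>".\<close>

section \<open>Heights and lexical colors\<close>

definition height :: "bstring \<Rightarrow> int" where
  "height w = (\<Sum>c\<leftarrow>w. if c then - 1 else 1)"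

lemma height_simps [simp]:
  "height [] = 0" "height (c # w) = (if c then - 1 else 1) + height w" "height (u @ v) = height u + height v"
  by (simp_all add: height_def)

lemma height_eq_count: "height w = int (length w) - 2 * int (count_list w True)"
  by (induction w) auto

lemma height_take_Suc: "i < length w \<Longrightarrow> height (take (Suc i) w) = height (take i w) + (if w ! i then - 1 else 1)"
  by (simp add: take_Suc_conv_app_nth)

lemma height_drop: "height (drop i w) = height w - height (take i w)"
  by (metis add_diff_cancel_left' append_take_drop_id height_simps(3))

lemma height_rotate [simp]: "height (rotate j w) = height w"
  by (metis add.commute append_take_drop_id height_simps(3) rotate_drop_take)

section \<open>Cyclic intervals and the heights at their ends\<close>

text \<open>Each position of the interval changes the surplus of zeros over ones by its step of the
  path, so comparing the two cardinalities in the definition of the color amounts to comparing two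
  heights.\<close>

lemma card_interval_height:
  assumes "y \<le> x" "x \<le> length b"
  shows "int (card ({y..<x} \<inter> {i. i < length b \<and> \<not> b ! i})) -
    int (card ({y..<x} \<inter> {i. i < length b \<and> b ! i})) = height (take x b) - height (take y b)"
  using assms
proof (induction x rule: dec_induct)
  case (step x)
  have *: "{y..<Suc x} \<inter> A = (if x \<in> A then insert x ({y..<x} \<inter> A) else {y..<x} \<inter> A)" for A
    using step.hyps(1) by (auto simp: less_Suc_eq)
  show ?case
    using step by (simp add: * height_take_Suc)
qed simp

lemma cyclic_interval_le:
  assumes "y < x" "x < n"
  shows "cyclic_interval n y x = {y..<x}"
proof -
  have [simp]: "(x + n - y) mod n = x - y"
    using assms by (simp add: mod_if)
  have "i \<in> cyclic_interval n y x" if "y \<le> i" "i < x" for i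
    unfolding cyclic_interval_def using that assms by (auto intro!: exI[of _ "i - y"])
  moreover have "cyclic_interval n y x \<subseteq> {y..<x}"
    unfolding cyclic_interval_def using assms by auto
  ultimately show ?thesis by auto
qed

lemma cyclic_interval_gt:
  assumes "x < y" "y < n"
  shows "cyclic_interval n y x = {y..<n} \<union> {0..<x}"
proof -
  have [simp]: "(x + n - y) mod n = x + n - y"
    using assms by simp
  have "i \<in> cyclic_interval n y x" if "y \<le> i" "i < n" for i
    unfolding cyclic_interval_def using that assms by (auto intro!: exI[of _ "i - y"])
  moreover have "i \<in> cyclic_interval n y x" if "i < x" for i
  proof -
    \<comment> \<open>The offset from \<open>y\<close> to \<open>i\<close> runs past the end of the
      string, hence the added \<open>n\<close>.\<close>
    have "y + (i + n - y) = i + n" "i < n" "i + n - y < x + n - y"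
      using that assms by linarith+
    then have "i = (y + (i + n - y)) mod n \<and> i + n - y < x + n - y"
      by simp
    then show ?thesis
      unfolding cyclic_interval_def by auto
  qed
  moreover have "cyclic_interval n y x \<subseteq> {y..<n} \<union> {0..<x}"
  proof
    fix i assume "i \<in> cyclic_interval n y x"
    then obtain t where t: "i = (y + t) mod n" "t < x + n - y"
      by (auto simp: cyclic_interval_def)
    show "i \<in> {y..<n} \<union> {0..<x}"
    proof (cases "y + t < n")
      case False
      then have "(y + t) mod n = y + t - n" using t assms by (simp add: le_mod_geq)
      then show ?thesis using t False assms by auto
    qed (use t in auto)
  qed
  ultimately show ?thesis by fastforce
qed

section \<open>Lexical colors as ranks\<close>

definition before :: "bstring \<Rightarrow> nat \<Rightarrow> nat \<Rightarrow> bool" where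
  "before b y x \<longleftrightarrow> height (take y b) < height (take x b) \<or> height (take y b) = height (take x b) \<and> x < y"

text \<open>Going once around the cycle raises the height by 1, so the cyclic comparison of \<open>y > x\<close>
  with \<open>x\<close> allows equal heights: lexical colors are ranks for the lexicographic order by
  increasing height and decreasing position.\<close>

lemma lexical_color_eq_card_before:
  assumes "height b = 1" "x < length b"
  shows "lexical_color b x = card {y. y < length b \<and> \<not> b ! y \<and> before b y x}"
proof -
  let ?n = "length b"
  let ?S = "{i. i < ?n \<and> b ! i}" and ?S' = "{i. i < ?n \<and> \<not> b ! i}"
  have "card (cyclic_interval ?n y x \<inter> ?S) < card (cyclic_interval ?n y x \<inter> ?S') \<longleftrightarrow> before b y x"
    if "y < ?n" "y \<noteq> x" for y
  proof (cases "y < x")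
    case True
    then show ?thesis
      using card_interval_height[of y x b] assms by (auto simp: cyclic_interval_le before_def)
  next
    case False
    then have lt: "x < y" using that by simp
    have "card (({y..<?n} \<union> {0..<x}) \<inter> A) = card ({y..<?n} \<inter> A) + card ({0..<x} \<inter> A)" for A
      unfolding Int_Un_distrib2 using lt by (intro card_Un_disjoint) auto
    then show ?thesis
      using card_interval_height[of y ?n b] card_interval_height[of 0 x b] assms that lt
      by (auto simp: cyclic_interval_gt before_def)
  qed
  moreover have "\<not> before b x x" by (simp add: before_def)
  ultimately show ?thesis
    unfolding lexical_color_def Let_def by (intro arg_cong[of _ _ card]) auto
qed

text \<open>Initial segments grow strictly along the order, so ranks are distinct; being
  \<open>card A\<close> many values below \<open>card A\<close>, they fill the whole range.\<close>

lemma rank_bij_betw: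
  fixes A :: "'a set"
  assumes "finite A"
    and irrefl: "\<And>x. x \<in> A \<Longrightarrow> \<not> r x x"
    and trans: "\<And>x y z. x \<in> A \<Longrightarrow> y \<in> A \<Longrightarrow> z \<in> A \<Longrightarrow> r x y \<Longrightarrow> r y z \<Longrightarrow> r x z"
    and total: "\<And>x y. x \<in> A \<Longrightarrow> y \<in> A \<Longrightarrow> x \<noteq> y \<Longrightarrow> r x y \<or> r y x"
  shows "bij_betw (\<lambda>x. card {y \<in> A. r y x}) A {..<card A}"
proof -
  have less: "card {z \<in> A. r z x} < card {z \<in> A. r z y}" if "x \<in> A" "y \<in> A" "r x y" for x y
  proof (rule psubset_card_mono)
    have "{z \<in> A. r z x} \<subseteq> {z \<in> A. r z y}"
      using trans[OF _ that(1,2) _ that(3)] by auto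
    then show "{z \<in> A. r z x} \<subset> {z \<in> A. r z y}"
      using that irrefl[OF that(1)] by auto
  qed (use \<open>finite A\<close> in simp)
  have inj: "inj_on (\<lambda>x. card {y \<in> A. r y x}) A"
  proof (rule inj_onI, rule ccontr)
    fix x y assume "x \<in> A" "y \<in> A" "x \<noteq> y" "card {z \<in> A. r z x} = card {z \<in> A. r z y}"
    then show False using total[of x y] less[of x y] less[of y x] by auto
  qed
  have "(\<lambda>x. card {y \<in> A. r y x}) ` A \<subseteq> {..<card A}"
  proof
    fix m assume "m \<in> (\<lambda>x. card {y \<in> A. r y x}) ` A"
    then obtain x where x: "x \<in> A" "m = card {y \<in> A. r y x}" by auto
    have "{y \<in> A. r y x} \<subset> A" using x irrefl[of x] by auto
    then show "m \<in> {..<card A}" using x \<open>finite A\<close> by (simp add: psubset_card_mono)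
  qed
  moreover have "card ((\<lambda>x. card {y \<in> A. r y x}) ` A) = card {..<card A}"
    using inj by (simp add: card_image)
  ultimately have "(\<lambda>x. card {y \<in> A. r y x}) ` A = {..<card A}"
    by (intro card_subset_eq) auto
  then show ?thesis using inj by (simp add: bij_betw_def)
qed

text \<open>The zeros exceed the ones by the height 1, so there are \<open>k + 1\<close> zeros and
  their ranks run through 0 to \<open>k\<close>. This is the factorization property at the lower
  level.\<close>

lemma lexical_color_bij_betw:
  assumes "height b = 1" "length b = 2 * k + 1"
  shows "bij_betw (lexical_color b) {x. x < length b \<and> \<not> b ! x} {0..k}"
proof -
  let ?A = "{x. x < length b \<and> \<not> b ! x}"
  have "int (card {i. i < length b \<and> \<not> b ! i}) - int (card {i. i < length b \<and> b ! i}) = 1"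
    using card_interval_height[of 0 "length b" b] assms
    by (simp add: Int_def lessThan_def flip: lessThan_atLeast0)
  moreover have "card {i. i < length b \<and> \<not> b ! i} + card {i. i < length b \<and> b ! i} = 2 * k + 1"
  proof -
    have "card {..<length b} = card ({i. i < length b \<and> \<not> b ! i} \<union> {i. i < length b \<and> b ! i})"
      by (rule arg_cong[of _ _ card]) auto
    also have "\<dots> = card {i. i < length b \<and> \<not> b ! i} + card {i. i < length b \<and> b ! i}"
      by (rule card_Un_disjoint) auto
    finally show ?thesis using assms(2) by simp
  qed
  ultimately have card: "card ?A = Suc k" by simp
  have "bij_betw (\<lambda>x. card {y \<in> ?A. before b y x}) ?A {..<card ?A}"
    by (rule rank_bij_betw) (auto simp: before_def)
  moreover have "card {y \<in> ?A. before b y x} = lexical_color b x" if "x \<in> ?A" for x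
    using that assms(1) by (auto simp: lexical_color_eq_card_before intro!: arg_cong[of _ _ card])
  moreover have "{..<card ?A} = {0..k}" using card by auto
  ultimately show ?thesis
    using bij_betw_cong[of ?A "\<lambda>x. card {y \<in> ?A. before b y x}"] by simp
qed

section \<open>Step counts of closed paths and complemented reversal\<close>

text \<open>The start height \<open>d\<close> is an argument so that counts add up along
  concatenations. In the application level 0 is the height reached right after the zero whose color
  is computed.\<close>

fun upsteps :: "int \<Rightarrow> bstring \<Rightarrow> nat" where
  "upsteps d [] = 0"
| "upsteps d (c # w) = (if \<not> c \<and> d < 0 then 1 else 0) + upsteps (d + (if c then - 1 else 1)) w"

lemma upsteps_append: "upsteps d (u @ v) = upsteps d u + upsteps (d + height u) v"
  by (induction u arbitrary: d) (auto simp: algebra_simps)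

text \<open>Induction from the right end leaves the prefix heights of the earlier positions
  unchanged.\<close>

lemma upsteps_eq_card: "upsteps d w = card {i. i < length w \<and> \<not> w ! i \<and> d + height (take i w) < 0}"
proof (induction w rule: rev_induct)
  case (snoc c w)
  have "{i. i < length (w @ [c]) \<and> \<not> (w @ [c]) ! i \<and> d + height (take i (w @ [c])) < 0} =
    {i. i < length w \<and> \<not> w ! i \<and> d + height (take i w) < 0} \<union>
    (if \<not> c \<and> d + height w < 0 then {length w} else {})"
    by (auto simp: nth_append less_Suc_eq split: if_splits)
  with snoc show ?case by (auto simp: upsteps_append card_insert_if)
qed simp

text \<open>Measured from the end of the up-step at \<open>x\<close>, a later zero starts below 0
  iff it is at most as high as \<open>x\<close>. An earlier zero is reached after the turn, one unit
  higher, and starts below 0 iff it is strictly lower. This absorbs the tie-break in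
  \<open>before\<close>.\<close>

lemma lexical_color_eq_upsteps:
  assumes "height b = 1" "x < length b" "\<not> b ! x"
  shows "lexical_color b x = upsteps 0 (drop (Suc x) b @ take x b)"
proof -
  let ?L = "{i. i < x \<and> \<not> b ! i \<and> height (take i b) < height (take x b)}"
  let ?R = "{i. i < length b - Suc x \<and> \<not> drop (Suc x) b ! i \<and> height (take i (drop (Suc x) b)) < 0}"
  have ht_R: "height (take i (drop (Suc x) b)) = height (take (Suc x + i) b) - height (take x b) - 1" for i
    using assms by (simp add: take_add height_take_Suc del: add_Suc)
  have "{y. y < length b \<and> \<not> b ! y \<and> before b y x} = ?L \<union> (\<lambda>i. Suc x + i) ` ?R"
  proof (intro set_eqI iffI)
    fix y assume y: "y \<in> {y. y < length b \<and> \<not> b ! y \<and> before b y x}"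
    show "y \<in> ?L \<union> (\<lambda>i. Suc x + i) ` ?R"
    proof (cases "y < x")
      case False
      moreover have "y \<noteq> x" using y by (auto simp: before_def)
      ultimately have "y = Suc x + (y - Suc x)" by simp
      moreover have "y - Suc x \<in> ?R"
        using y False \<open>y \<noteq> x\<close> by (auto simp: ht_R before_def)
      ultimately show ?thesis by blast
    qed (use y in \<open>auto simp: before_def\<close>)
  next
    fix y assume "y \<in> ?L \<union> (\<lambda>i. Suc x + i) ` ?R"
    then show "y \<in> {y. y < length b \<and> \<not> b ! y \<and> before b y x}"
      using assms by (auto simp: ht_R before_def)
  qed
  moreover have "card (?L \<union> (\<lambda>i. Suc x + i) ` ?R) = card ?L + card ?R"
    by (subst card_Un_disjoint) (auto simp: card_image inj_on_def)
  moreover have "height (drop (Suc x) b) = - height (take x b)"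
    using assms by (simp add: height_drop height_take_Suc)
  moreover have "upsteps (- height (take x b)) (take x b) = card ?L"
    using assms(2) unfolding upsteps_eq_card by (intro arg_cong[of _ _ card]) (auto simp: min_def)
  moreover have "upsteps 0 (drop (Suc x) b) = card ?R"
    unfolding upsteps_eq_card by simp
  ultimately show ?thesis
    using assms by (simp add: lexical_color_eq_card_before upsteps_append)
qed

text \<open>The bound is \<open>d \<le> 0\<close> rather than \<open>d < 0\<close> because a
  down-step is measured at its upper end: it covers the same unit of height as an up-step starting
  at \<open>d - 1\<close>.\<close>

fun downsteps :: "int \<Rightarrow> bstring \<Rightarrow> nat" where
  "downsteps d [] = 0"
| "downsteps d (c # w) = (if c \<and> d \<le> 0 then 1 else 0) + downsteps (d + (if c then - 1 else 1)) w"

lemma downsteps_append: "downsteps d (u @ v) = downsteps d u + downsteps (d + height u) v"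
  by (induction u arbitrary: d) (auto simp: algebra_simps)

text \<open>The counted steps are exactly those that change the minimum of the current height and 0,
  so the difference telescopes.\<close>

lemma upsteps_minus_downsteps:
  "int (upsteps d w) - int (downsteps d w) = min (d + height w) 0 - min d 0"
  by (induction d w rule: upsteps.induct) (auto simp: algebra_simps)

lemma height_aleph: "height (aleph w) = - height w"
  by (induction w) (auto simp: aleph_def)

lemma length_aleph [simp]: "length (aleph w) = length w"
  by (simp add: aleph_def)

text \<open>\<open>aleph w\<close> traces the path of \<open>w\<close> backwards from its end
  height, which turns each counted down-step into an up-step from below 0.\<close>

lemma upsteps_aleph: "upsteps (d + height w) (aleph w) = downsteps d w"
  by (induction w arbitrary: d rule: rev_induct) (auto simp: aleph_def downsteps_append)

text \<open>A closed path climbs through each level as often as it descends through it.\<close>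

lemma upsteps_aleph_closed: "height w = 0 \<Longrightarrow> upsteps 0 (aleph w) = upsteps 0 w"
  using upsteps_aleph[of 0 w] upsteps_minus_downsteps[of 0 w] by simp

text \<open>Without the changed entry, the two strings leave the closed path \<open>v @ u\<close>
  and its mirror image \<open>aleph (v @ u)\<close>, whose counts of up-steps agree.\<close>

lemma lexical_color_aleph:
  assumes "height b = 1" "x < length b" "\<not> b ! x"
  shows "lexical_color (aleph (b[x := True])) (length b - 1 - x) = lexical_color b x"
proof -
  define u v where "u = take x b" and "v = drop (Suc x) b"
  have b: "b = u @ False # v" and x: "x = length u"
    using assms id_take_nth_drop[of x b] by (auto simp: u_def v_def)
  have aleph: "aleph (b[x := True]) = aleph v @ False # aleph u"
    by (simp add: b x aleph_def)
  have "lexical_color (aleph (b[x := True])) (length b - 1 - x) = upsteps 0 (aleph (v @ u))"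
    using assms(1) unfolding aleph
    by (subst lexical_color_eq_upsteps) (simp_all add: b x height_aleph nth_append, simp add: aleph_def)
  also have "\<dots> = lexical_color b x"
    using assms by (simp add: lexical_color_eq_upsteps upsteps_aleph_closed)
      (simp add: b x upsteps_aleph_closed)
  finally show ?thesis .
qed

text \<open>The entry at \<open>i\<close> comes from position \<open>Suc i mod length b\<close>, and
  the closed path that follows it is literally the same string before and after the
  rotation.\<close>

lemma lexical_color_rotate1:
  assumes "height b = 1" "i < length b" "\<not> b ! (Suc i mod length b)"
  shows "lexical_color (rotate1 b) i = lexical_color b (Suc i mod length b)"
proof (cases b)
  case (Cons c b')
  show ?thesis
  proof (cases "i < length b'")
    case True
    then show ?thesis
      using assms by (simp add: Cons lexical_color_eq_upsteps nth_append)
  next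
    case False
    then have "i = length b'" using assms(2) Cons by simp
    then show ?thesis
      using assms by (simp add: Cons lexical_color_eq_upsteps nth_append)
  qed
qed (use assms in simp)

section \<open>Label strings\<close>

text \<open>A version of \<open>labels\<close> that depends on positions only and makes sense for
  every length, as the recursion on shorter strings requires; \<open>labels_eq_lex_labels\<close>
  relates the two.\<close>

definition lex_labels :: "bstring \<Rightarrow> lstring" where
  "lex_labels b = map (\<lambda>i. if b ! i then None else Some (lexical_color b i)) [0..<length b]"

lemma length_lex_labels [simp]: "length (lex_labels b) = length b"
  by (simp add: lex_labels_def)

lemma nth_lex_labels: "i < length b \<Longrightarrow> lex_labels b ! i = (if b ! i then None else Some (lexical_color b i))"
  by (simp add: lex_labels_def)

lemma lex_labels_rotate:
  assumes "height b = 1"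
  shows "lex_labels (rotate j b) = rotate j (lex_labels b)"
proof (induction j)
  case (Suc j)
  have "lex_labels (rotate1 c) = rotate1 (lex_labels c)" if "height c = 1" for c
  proof (rule nth_equalityI)
    fix i assume "i < length (lex_labels (rotate1 c))"
    then have "i < length c" "Suc i mod length c < length c" by (auto intro: mod_less_divisor)
    then show "lex_labels (rotate1 c) ! i = rotate1 (lex_labels c) ! i"
      using that by (simp add: nth_rotate1 nth_lex_labels lexical_color_rotate1)
  qed simp
  with Suc assms show ?case by simp
qed simp

lemma count_list_eq_card: "count_list xs y = card {i. i < length xs \<and> xs ! i = y}"
  unfolding count_list_eq_length_filter length_filter_conv_card by (metis (no_types))

lemma lex_labels_unique:
  assumes "height b = 1" "length b = 2 * k + 1" "a \<le> k"
  shows "\<exists>!i. i < length b \<and> lex_labels b ! i = Some a"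
proof -
  have bij: "bij_betw (lexical_color b) {x. x < length b \<and> \<not> b ! x} {0..k}"
    using assms by (rule_tac lexical_color_bij_betw)
  have "a \<in> lexical_color b ` {x. x < length b \<and> \<not> b ! x}"
    using bij assms(3) by (simp add: bij_betw_def)
  then obtain x where x: "x < length b" "\<not> b ! x" "lexical_color b x = a"
    by blast
  show ?thesis
  proof (intro ex1I[of _ x])
    fix y assume y: "y < length b \<and> lex_labels b ! y = Some a"
    then have "\<not> b ! y" "lexical_color b y = a"
      by (auto simp: nth_lex_labels split: if_splits)
    with y x show "y = x"
      using bij by (auto simp: bij_betw_def dest: inj_onD)
  qed (use x in \<open>simp add: nth_lex_labels\<close>)
qed

lemma count_lex_labels:
  assumes "height b = 1" "length b = 2 * k + 1" "a \<le> k"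
  shows "count_list (lex_labels b) (Some a) = 1"
proof -
  obtain x where "{i. i < length b \<and> lex_labels b ! i = Some a} = {x}"
    using lex_labels_unique[OF assms] by blast
  then show ?thesis by (simp add: count_list_eq_card)
qed

section \<open>Rotating a string to a given label\<close>

text \<open>Generalizes \<open>from_zero\<close> to any label; it is the operation by which an entry
  of a germ acts. A string without the label stays as it is.\<close>

definition rot_to :: "nat \<Rightarrow> lstring \<Rightarrow> lstring" where
  "rot_to a s = dropWhile (\<lambda>x. x \<noteq> Some a) s @ takeWhile (\<lambda>x. x \<noteq> Some a) s"

lemma from_zero_eq: "from_zero = rot_to 0"
  by (simp add: fun_eq_iff from_zero_def rot_to_def)

lemma rot_to_Cons [simp]: "rot_to a (Some a # s) = Some a # s"
  by (simp add: rot_to_def)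

lemma rot_to_eq_rotate: "\<exists>j. rot_to a s = rotate j s"
  unfolding rot_to_def by (metis rotate_append takeWhile_dropWhile_id)

lemma hd_rot_to: "Some a \<in> set s \<Longrightarrow> \<exists>t. rot_to a s = Some a # t"
  using dropWhile_eq_Cons_conv[of "\<lambda>x. x \<noteq> Some a" s "Some a" "tl (dropWhile (\<lambda>x. x \<noteq> Some a) s)"]
    hd_dropWhile[of "\<lambda>x. x \<noteq> Some a" s] dropWhile_eq_Nil_conv[of "\<lambda>x. x \<noteq> Some a" s]
  unfolding rot_to_def by (metis append_Cons hd_Cons_tl)

text \<open>With a single occurrence of the label only the cyclic string matters: a rotation step
  moves either the label itself or an entry in front of it to the end.\<close>

lemma rot_to_rotate:
  assumes "count_list s (Some a) = 1"
  shows "rot_to a (rotate j s) = rot_to a s"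
proof (induction j)
  case (Suc j)
  have cnt: "count_list (rotate j s) (Some a) = 1" for j
    using assms by (metis add.commute append_take_drop_id count_list_append rotate_drop_take)
  have "rot_to a (rotate1 t) = rot_to a t" if t: "count_list t (Some a) = 1" for t
  proof (cases t)
    case (Cons c t')
    show ?thesis
    proof (cases "c = Some a")
      case True
      then have "\<forall>x\<in>set t'. x \<noteq> Some a"
        using t Cons by (auto simp: count_list_0_iff)
      then show ?thesis using Cons True by (simp add: rot_to_def)
    next
      case False
      then have "Some a \<in> set t'"
        using t Cons by (metis count_list.simps(2) count_notin zero_neq_one)
      then show ?thesis using Cons False by (simp add: rot_to_def)
    qed
  qed simp
  with cnt Suc show ?case by simp
qed simp

section \<open>Wrapping ballot strings\<close>

text \<open>The counterpart on label strings of passing from \<open>u\<close> to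
  \<open>False # u @ [True]\<close>.\<close>

definition wrap :: "lstring \<Rightarrow> lstring" where
  "wrap s = Some 0 # map (map_option Suc) s @ [None]"

lemma wrap_inj: "wrap s = wrap t \<Longrightarrow> s = t"
  using inj_map_eq_map[OF option.inj_map[OF inj_Suc]] by (simp add: wrap_def)

definition ballot :: "bstring \<Rightarrow> bool" where
  "ballot u \<longleftrightarrow> height u = 1 \<and> (\<forall>i. 0 \<le> height (take i u))"

text \<open>The leading 0 is the only zero of height 0, all others having height at least 1. So it
  gets color 0 and raises the rank of every other zero by one.\<close>

lemma lex_labels_wrap:
  assumes "ballot u"
  shows "lex_labels (False # u @ [True]) = wrap (lex_labels u)"
proof (rule nth_equalityI)
  let ?t = "False # u @ [True]"
  fix i assume "i < length (lex_labels ?t)"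
  then consider "i = 0" | j where "i = Suc j" "j < length u" | "i = Suc (length u)"
    by (cases i) (auto simp: less_Suc_eq)
  then show "lex_labels ?t ! i = wrap (lex_labels u) ! i"
  proof cases
    case 1
    have "{y. y < length ?t \<and> \<not> ?t ! y \<and> before ?t y 0} = {}"
    proof -
      have False if "y < length ?t" "\<not> ?t ! y" "before ?t y 0" for y
      proof (cases y)
        case (Suc z)
        then have "z < length u"
          using that(1,2) by (auto simp: nth_append less_Suc_eq)
        moreover have "0 \<le> height (take z u)"
          using assms by (simp add: ballot_def)
        ultimately show False
          using that(3) Suc by (simp add: before_def)
      qed (use that in \<open>simp add: before_def\<close>)
      then show ?thesis by blast
    qed
    then have "lexical_color ?t 0 = 0"
      using assms by (subst lexical_color_eq_card_before) (simp_all add: ballot_def)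
    then show ?thesis using 1 by (simp add: nth_lex_labels wrap_def)
  next
    case (2 j)
    show ?thesis
    proof (cases "u ! j")
      case False
      have "{y. y < length ?t \<and> \<not> ?t ! y \<and> before ?t y (Suc j)} =
        insert 0 (Suc ` {y. y < length u \<and> \<not> u ! y \<and> before u y j})" (is "?A = ?B")
      proof (rule set_eqI)
        fix y
        show "y \<in> ?A \<longleftrightarrow> y \<in> ?B"
        proof (cases y)
          case 0
          have "before ?t 0 (Suc j)"
            using assms 2 by (simp add: before_def ballot_def add_pos_nonneg)
          then show ?thesis using 0 by simp
        next
          case (Suc z)
          then show ?thesis
            using 2 by (auto simp: before_def nth_append)
        qed
      qed
      then have "lexical_color ?t (Suc j) = Suc (lexical_color u j)"
        using assms 2 by (simp add: lexical_color_eq_card_before ballot_def card_image)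
      then show ?thesis using 2 False by (simp add: nth_lex_labels wrap_def nth_append)
    qed (use 2 in \<open>simp add: nth_lex_labels wrap_def nth_append\<close>)
  qed (simp add: nth_lex_labels wrap_def nth_append)
qed (simp add: wrap_def)

text \<open>Both sides say that \<open>q\<close> has height at most 1. For the colors: beyond
  position 0 all heights of \<open>t\<close> are at least 1, and position 1 ranks last among the
  zeros of height at most 1. For the rotation: cut at height \<open>h\<close>, the path reaches the
  end of \<open>t\<close> at height \<open>1 - h\<close>.\<close>

lemma rotate_nonneg_iff:
  assumes u: "ballot u" and q: "q < length u + 2" "\<not> (False # u @ [True]) ! q"
  defines "t \<equiv> False # u @ [True]"
  shows "(\<forall>i. 0 \<le> height (take i (rotate q t))) \<longleftrightarrow> lexical_color t q \<le> lexical_color t 1"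
proof -
  have len: "length t = length u + 2" by (simp add: t_def)
  have ht_t: "height t = 1" using u by (simp add: t_def ballot_def)
  have pos: "1 \<le> height (take i t)" if "0 < i" for i
  proof (cases "i \<le> Suc (length u)")
    case True
    then have "take i t = False # take (i - 1) u"
      using that by (cases i) (auto simp: t_def)
    then show ?thesis using u by (simp add: ballot_def)
  next
    case False
    then have "take i t = t" by (simp add: t_def)
    then show ?thesis using ht_t by simp
  qed
  have "u \<noteq> []" using u by (auto simp: ballot_def)
  then have u0: "\<not> u ! 0"
    using u by (cases u) (auto simp: ballot_def split: if_splits dest: spec[of _ 1])
  then have t1: "\<not> t ! 1" and ht1: "height (take 1 t) = 1"
    using \<open>u \<noteq> []\<close> by (simp_all add: t_def nth_append)
  have color: "lexical_color t x = card {y. y < length t \<and> \<not> t ! y \<and> before t y x}"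
    if "x < length t" for x
    using that ht_t by (rule_tac lexical_color_eq_card_before)
  have q': "q < length t" "\<not> t ! q" using q len by (simp_all add: t_def)
  have "lexical_color t q \<le> lexical_color t 1 \<longleftrightarrow> height (take q t) \<le> 1"
  proof
    assume le: "height (take q t) \<le> 1"
    have "before t y 1" if "before t y q" for y
    proof (cases "y = 0")
      case False
      then show ?thesis
        using that pos[of y] le ht1 \<open>before t y q\<close> pos[of q] by (cases "q = 0") (auto simp: before_def)
    qed (use ht1 in \<open>simp add: before_def\<close>)
    then have "{y. y < length t \<and> \<not> t ! y \<and> before t y q} \<subseteq> {y. y < length t \<and> \<not> t ! y \<and> before t y 1}"
      by blast
    then show "lexical_color t q \<le> lexical_color t 1"
      using color q' len by (simp add: card_mono)
  next
    assume le: "lexical_color t q \<le> lexical_color t 1"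
    show "height (take q t) \<le> 1"
    proof (rule ccontr)
      assume gt: "\<not> height (take q t) \<le> 1"
      \<comment> \<open>Properness comes from position 1, which precedes \<open>q\<close> but not
        itself.\<close>
      then have "{y. y < length t \<and> \<not> t ! y \<and> before t y 1} \<subset> {y. y < length t \<and> \<not> t ! y \<and> before t y q}"
        using t1 ht1 len by (intro psubsetI) (auto simp: before_def set_eq_iff intro!: exI[of _ 1])
      then have "lexical_color t 1 < lexical_color t q"
        using color q' len by (simp add: psubset_card_mono)
      with le show False by simp
    qed
  qed
  moreover have "(\<forall>i. 0 \<le> height (take i (rotate q t))) \<longleftrightarrow> height (take q t) \<le> 1"
  proof
    assume "\<forall>i. 0 \<le> height (take i (rotate q t))"
    \<comment> \<open>This prefix is the tail \<open>drop q t\<close>, of height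
      \<open>1 - height (take q t)\<close>.\<close>
    then have "0 \<le> height (take (length t - q) (rotate q t))" by blast
    also have "take (length t - q) (rotate q t) = drop q t"
      using q' by (simp add: rotate_drop_take)
    finally show "height (take q t) \<le> 1" by (simp add: height_drop ht_t)
  next
    assume le: "height (take q t) \<le> 1"
    show "\<forall>i. 0 \<le> height (take i (rotate q t))"
    proof
      fix i
      have "height (take q t) \<le> height (take (q + i) t)"
        using pos[of "q + i"] le by (cases "q = 0"; cases "i = 0") auto
      then have 1: "0 \<le> height (take i (drop q t))"
        by (simp add: take_add)
      have 2: "0 \<le> height (take j t)" for j
        using pos[of j] by (cases "j = 0") auto
      show "0 \<le> height (take i (rotate q t))"
      proof (cases "i \<le> length t - q")
        case True
        then show ?thesis using 1 q' by (simp add: rotate_drop_take)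
      next
        case False
        \<comment> \<open>Past the tail the path continues from the nonnegative height
          \<open>1 - height (take q t)\<close> along a prefix of \<open>t\<close>.\<close>
        then have "take i (rotate q t) = drop q t @ take (i - (length t - q)) (take q t)"
          using q' by (simp add: rotate_drop_take)
        then show ?thesis using le 2 by (simp add: height_drop ht_t min_def)
      qed
    qed
  qed
  ultimately show ?thesis by simp
qed

section \<open>Splitting off the outer 0 and 1\<close>

text \<open>A path that is ever below 0 and ends at or above 0 must climb back by an up-step from
  below 0.\<close>

lemma upsteps_eq_0_imp_nonneg:
  assumes "upsteps d w = 0" "0 \<le> d + height w"
  shows "0 \<le> d + height (take i w)"
  using assms
proof (induction d w arbitrary: i rule: upsteps.induct)
  case (2 d c w)
  have IH: "0 \<le> d + (if c then - 1 else 1) + height (take j w)" for j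
    using 2 by (simp split: if_splits)
  show ?case
  proof (cases i)
    case 0
    then show ?thesis using IH[of 0] 2(2) by (simp split: if_splits)
  next
    case (Suc j)
    then show ?thesis using IH[of j] by simp
  qed
qed simp

text \<open>Color 0 says that the closed path \<open>w\<close> behind the first zero never goes
  below 0. As it ends at 0, its last step is a down-step.\<close>

lemma lexical_color_0_decomp:
  assumes "height c = 1" "length c = 2 * m + 3" "\<not> c ! 0" "lexical_color c 0 = 0"
  shows "\<exists>u. ballot u \<and> c = False # u @ [True]"
proof -
  obtain w where c: "c = False # w" using assms by (cases c) auto
  then have len: "length w = 2 * m + 2" and ht_w: "height w = 0" and "upsteps 0 w = 0"
    using assms by (simp_all add: lexical_color_eq_upsteps)
  then have nonneg: "0 \<le> height (take i w)" for i
    using upsteps_eq_0_imp_nonneg[of 0 w i] by simp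
  have "w \<noteq> []" using len by auto
  then have w: "w = butlast w @ [last w]" by simp
  have "0 \<le> height (butlast w)" using nonneg by (simp add: butlast_conv_take)
  moreover have "height (butlast w) + (if last w then - 1 else 1) = 0"
    using ht_w w by (metis add.right_neutral height_simps)
  ultimately have last: "last w" and "height (butlast w) = 1" by (auto split: if_splits)
  moreover have "0 \<le> height (take i (butlast w))" for i
    using nonneg by (simp add: butlast_conv_take)
  ultimately have "ballot (butlast w)" by (simp add: ballot_def)
  then show ?thesis using c w last by metis
qed

lemma rotation_decomp:
  assumes "height b = 1" "length b = 2 * m + 3"
  shows "\<exists>j u. ballot u \<and> rotate j b = False # u @ [True]"
proof -
  obtain p where p: "p < length b" "lex_labels b ! p = Some 0"
    using lex_labels_unique[of b "Suc m" 0] assms by auto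
  have "rotate p (lex_labels b) ! 0 = Some 0"
    using p by (subst nth_rotate) auto
  then have "lex_labels (rotate p b) ! 0 = Some 0"
    using assms by (simp add: lex_labels_rotate)
  then have "\<not> rotate p b ! 0 \<and> lexical_color (rotate p b) 0 = 0"
    using assms by (simp add: nth_lex_labels split: if_splits)
  then show ?thesis
    using lexical_color_0_decomp[of "rotate p b" m] assms by auto
qed

text \<open>For nonempty \<open>xs\<close> the number \<open>j * length xs - j\<close> is a
  nonnegative representative of \<open>- j\<close> modulo the length.\<close>

lemma rotate_inverse: "rotate (j * length xs - j) (rotate j xs) = xs"
proof (cases "xs = []")
  case False
  then have "j * length xs - j + j = j * length xs"
    by (cases "length xs") auto
  then show ?thesis
    by (simp add: rotate_rotate rotate_id)
qed simp

lemma rot_to_nth: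
  assumes "count_list s (Some a) = 1" "q < length s" "s ! q = Some a"
  shows "rot_to a s = rotate q s"
proof -
  have "rotate q s ! 0 = Some a"
    using assms by (subst nth_rotate) auto
  moreover have "rotate q s \<noteq> []" using assms by auto
  ultimately obtain s' where "rotate q s = Some a # s'"
    by (cases "rotate q s") auto
  then show ?thesis using rot_to_rotate[OF assms(1), of q] by simp
qed

section \<open>Germs\<close>

text \<open>The argument lists \<open>a\<^sub>1, a\<^sub>2, \<dots>\<close>, in the order opposite to that of a germ.\<close>

fun germ_core :: "nat list \<Rightarrow> lstring" where
  "germ_core [] = [Some 0]"
| "germ_core (a # as) = rot_to a (wrap (germ_core as))"

text \<open>This is the first label of \<open>germ_core as\<close>. The value 0 at the empty list
  turns the bound in \<open>rev_germ\<close> into \<open>a \<le> 1\<close> for the last entry of the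
  list, that is, the leftmost entry of the germ.\<close>

definition germ_top :: "nat list \<Rightarrow> nat" where
  "germ_top as = (case as of [] \<Rightarrow> 0 | a # _ \<Rightarrow> a)"

fun rev_germ :: "nat list \<Rightarrow> bool" where
  "rev_germ [] = True"
| "rev_germ (a # as) = (rev_germ as \<and> a \<le> Suc (germ_top as))"

text \<open>Wrapping moves the first label of \<open>u\<close> to position 1 and raises it by 1. The
  germ condition on \<open>a\<close> is therefore the color bound in
  \<open>rotate_nonneg_iff\<close>, and the rotation is again a ballot string.\<close>

lemma germ_core_ballot:
  assumes "rev_germ as"
  shows "hd (germ_core as) = Some (germ_top as) \<and> (\<exists>u. ballot u \<and> length u = 2 * length as + 1 \<and> germ_core as = lex_labels u)"
  using assms
proof (induction as)
  case Nil
  have "lex_labels [False] = [Some 0]" "ballot [False]"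
    by (auto simp: lex_labels_def lexical_color_eq_upsteps ballot_def take_Cons')
  then show ?case by (auto simp: germ_top_def intro!: exI[of _ "[False]"])
next
  case (Cons a as)
  then obtain u where u: "ballot u" "length u = 2 * length as + 1" "germ_core as = lex_labels u"
    and hd: "hd (germ_core as) = Some (germ_top as)" by auto
  let ?t = "False # u @ [True]"
  have "lex_labels u ! 0 = Some (germ_top as)"
    using u hd by (cases "lex_labels u") (auto simp flip: length_0_conv)
  have t1: "lex_labels ?t ! 1 = Some (Suc (germ_top as))"
    using u hd \<open>lex_labels u ! 0 = Some (germ_top as)\<close> by (simp add: lex_labels_wrap wrap_def nth_append)
  then have color1: "lexical_color ?t 1 = Suc (germ_top as)" and nth1: "\<not> ?t ! 1"
    using u(2) by (auto simp add: nth_lex_labels split: if_splits)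
  have ht_t: "height ?t = 1" and len: "length ?t = 2 * Suc (length as) + 1"
    using u by (simp_all add: ballot_def)
  \<comment> \<open>All colors of \<open>?t\<close> are at most \<open>Suc (length as)\<close>; with
    the germ condition this puts \<open>a\<close> in the range of labels that occur.\<close>
  have "Suc (germ_top as) \<le> Suc (length as)"
    using lexical_color_bij_betw[OF ht_t len] color1 nth1 len unfolding bij_betw_def by force
  then have a: "a \<le> Suc (length as)" using Cons.prems by simp
  obtain q where q: "q < length ?t" "lex_labels ?t ! q = Some a"
    using lex_labels_unique[OF ht_t len a] by blast
  then have color_q: "lexical_color ?t q = a" and nth_q: "\<not> ?t ! q"
    by (auto simp only: nth_lex_labels split: if_splits)
  have germ_core: "germ_core (a # as) = lex_labels (rotate q ?t)"
  proof -
    have "rot_to a (lex_labels ?t) = rotate q (lex_labels ?t)"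
      using rot_to_nth[OF count_lex_labels[OF ht_t len a], of q] q by (simp only: length_lex_labels)
    then show ?thesis
      using u by (simp only: germ_core.simps lex_labels_rotate[OF ht_t] flip: lex_labels_wrap)
  qed
  have "ballot (rotate q ?t)"
    unfolding ballot_def using rotate_nonneg_iff[OF u(1), of q] q nth_q color_q color1 Cons.prems ht_t
    by (simp del: height_simps)
  moreover have "hd (germ_core (a # as)) = Some a"
  proof -
    have "Some a \<in> set (wrap (germ_core as))"
      using q u by (metis lex_labels_wrap length_lex_labels nth_mem)
    then show ?thesis using hd_rot_to[of a "wrap (germ_core as)"] by auto
  qed
  ultimately show ?case
    using germ_core len by (auto simp: germ_top_def simp del: germ_core.simps intro!: exI[of _ "rotate q ?t"])
qed

text \<open>The recursion is run backwards: \<open>u\<close>, rotated to its label 0 and stripped of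
  the outer 0 and 1, leaves a shorter ballot string \<open>v\<close>. The new entry \<open>a\<close>
  is the label in \<open>False # v @ [True]\<close> of the zero at which \<open>u\<close>
  starts.\<close>

lemma ballot_imp_germ_core:
  assumes "ballot u" "length u = 2 * m + 1"
  shows "\<exists>as. rev_germ as \<and> length as = m \<and> germ_core as = lex_labels u"
  using assms
proof (induction m arbitrary: u)
  case 0
  then have "u = [False]"
    by (cases u) (auto simp: ballot_def split: if_splits)
  then show ?case
    by (auto simp: lex_labels_def lexical_color_eq_upsteps intro!: exI[of _ "[]"])
next
  case (Suc m)
  then have ht_u: "height u = 1" by (simp add: ballot_def)
  obtain j v where v: "ballot v" and j: "rotate j u = False # v @ [True]"
    using rotation_decomp[OF ht_u, of m] Suc.prems(2) by auto
  have len: "length v = 2 * m + 1"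
    using arg_cong[OF j, of length] Suc.prems(2) by simp
  let ?t = "False # v @ [True]"
  obtain as where as: "rev_germ as" "length as = m" "germ_core as = lex_labels v"
    using Suc.IH[OF v len] by blast
  have ht_t: "height ?t = 1" and len_t: "length ?t = 2 * Suc m + 1"
    using v len by (simp_all add: ballot_def)
  \<comment> \<open>This undoes the rotation by \<open>j\<close>; reduced modulo the length it
    yields the position \<open>q\<close> of \<open>?t\<close> at which \<open>u\<close>
    starts.\<close>
  obtain i where "rotate i ?t = u"
    using rotate_inverse[of j u] j by metis
  then obtain q where q: "q < length ?t" "rotate q ?t = u"
    by (metis len_t rotate_conv_mod mod_less_divisor zero_less_Suc add.commute plus_1_eq_Suc)
  have "0 < length u" using Suc.prems(2) by simp
  then have "u \<noteq> []" "0 \<le> height (take 1 u)" using Suc.prems(1) by (simp_all add: ballot_def)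
  \<comment> \<open>A ballot string starts with a 0, so position \<open>q\<close> carries a number
    and not an asterisk.\<close>
  then have "\<not> u ! 0" by (cases u) (auto split: if_splits)
  moreover have "u ! 0 = ?t ! q"
    using q \<open>0 < length u\<close> nth_rotate[of 0 ?t q] by simp
  ultimately have nth_q: "\<not> ?t ! q" by simp
  define a where "a = lexical_color ?t q"
  have lex_labels_q: "lex_labels ?t ! q = Some a"
    using q nth_q by (simp only: nth_lex_labels a_def) simp
  have "a \<le> Suc m"
    using lexical_color_bij_betw[OF ht_t len_t] q nth_q unfolding bij_betw_def a_def by force
  then have "rot_to a (lex_labels ?t) = rotate q (lex_labels ?t)"
    using rot_to_nth[OF count_lex_labels[OF ht_t len_t], of a q] q lex_labels_q by (simp only: length_lex_labels)
  then have "germ_core (a # as) = lex_labels u"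
    using q(2) by (simp only: germ_core.simps as(3) lex_labels_rotate[OF ht_t, symmetric] flip: lex_labels_wrap[OF v])
  moreover have "a \<le> lexical_color ?t 1"
    using rotate_nonneg_iff[OF v, of q] q nth_q Suc.prems(1) by (simp add: a_def ballot_def)
  moreover have "lexical_color ?t 1 = Suc (germ_top as)"
  proof -
    have "lex_labels v ! 0 = Some (germ_top as)"
      using germ_core_ballot[OF as(1)] as(3) len by (cases "lex_labels v") (auto simp flip: length_0_conv)
    then have "lex_labels ?t ! 1 = Some (Suc (germ_top as))"
      using v len by (simp add: lex_labels_wrap wrap_def nth_append)
    then show ?thesis using len by (auto simp: nth_lex_labels split: if_splits)
  qed
  ultimately have "rev_germ (a # as) \<and> length (a # as) = Suc m \<and> germ_core (a # as) = lex_labels u"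
    using as by simp
  then show ?case by blast
qed

text \<open>The first label returns the entry \<open>a\<close>; rotating back to the label 0 and
  unwrapping returns the core of the remaining list.\<close>

lemma germ_core_inj:
  assumes "rev_germ as" "rev_germ bs" "length as = length bs" "germ_core as = germ_core bs"
  shows "as = bs"
  using assms
proof (induction as arbitrary: bs)
  case (Cons a as)
  then obtain b bs' where bs: "bs = b # bs'" by (cases bs) auto
  have ab: "a = b"
    using germ_core_ballot[OF Cons.prems(1)] germ_core_ballot[OF Cons.prems(2)] Cons.prems(4) bs by (simp add: germ_top_def)
  have unrotate: "rot_to 0 (germ_core (x # xs)) = wrap (germ_core xs)" if xs: "rev_germ xs" for x xs
  proof -
    obtain u where u: "ballot u" "length u = 2 * length xs + 1" "germ_core xs = lex_labels u"
      using germ_core_ballot[OF xs] by blast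
    then have "count_list (wrap (germ_core xs)) (Some 0) = 1"
      using count_lex_labels[of "False # u @ [True]" "Suc (length xs)" 0] by (simp add: lex_labels_wrap ballot_def)
    then show ?thesis
      using rot_to_eq_rotate[of x "wrap (germ_core xs)"] rot_to_rotate by (auto simp: wrap_def)
  qed
  have "wrap (germ_core as) = wrap (germ_core bs')"
    using unrotate[of as a] unrotate[of bs' b] Cons.prems bs by simp
  then have "as = bs'"
    using Cons bs by (auto dest!: wrap_inj)
  then show ?case using ab bs by simp
qed simp

section \<open>Iterated wrapping and the exchange of blocks in \<open>germ_string\<close>\<close>

text \<open>The outer blocks are the substrings \<open>W\<close> and \<open>Z\<close> in the
  construction of \<open>germ_string\<close>; the shifted core is the middle part
  \<open>XY\<close>.\<close>

lemma wrap_funpow: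
  "(wrap ^^ i) s = map Some [0..<i] @ map (map_option ((+) i)) s @ replicate i None"
proof (induction i)
  case 0
  then show ?case by (simp add: option.map_ident cong: map_cong)
next
  case (Suc i)
  have "map Some [0..<Suc i] = Some 0 # map (map_option Suc) (map Some [0..<i])"
    by (rule nth_equalityI) (auto simp: nth_Cons' simp del: upt_Suc)
  moreover have "map_option Suc \<circ> map_option ((+) i) = map_option ((+) (Suc i))"
  proof
    show "(map_option Suc \<circ> map_option ((+) i)) x = map_option ((+) (Suc i)) x" for x
      by (cases x) simp_all
  qed
  moreover have "(wrap ^^ Suc i) s =
      wrap (map Some [0..<i] @ map (map_option ((+) i)) s @ replicate i None)"
    using Suc by simp
  moreover have "map (map_option Suc) (replicate i None) @ [None] = replicate (Suc i) (None :: nat option)"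
    by (simp add: replicate_append_same)
  ultimately show ?case
    unfolding wrap_def by (simp only: map_append map_map append_assoc append_Cons)
qed

text \<open>A wrapped string already begins with the label 0, so an entry 0 causes no
  rotation.\<close>

lemma germ_core_zeros: "germ_core (replicate j 0 @ as) = (wrap ^^ j) (germ_core as)"
proof (induction j)
  case (Suc j)
  then show ?case by (simp add: wrap_def)
qed simp

lemma rev_germ_append: "rev_germ (xs @ ys) \<Longrightarrow> rev_germ ys"
  by (induction xs) auto

lemma rev_germ_zeros: "rev_germ as \<Longrightarrow> rev_germ (replicate j 0 @ as)"
  by (induction j) auto

lemma entry_Suc: "i < length \<alpha> \<Longrightarrow> entry \<alpha> (Suc i) = rev \<alpha> ! i"
  by (simp add: entry_def rev_nth)

text \<open>Let \<open>a\<close> be the rightmost nonzero entry, followed by \<open>j\<close> zeros.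
  The strings for \<open>\<alpha>\<close> and \<open>beta \<alpha>\<close> are both
  \<open>Suc j\<close> wraps around rotations of \<open>wrap (germ_core as)\<close>, to the labels
  \<open>a\<close> and \<open>a - 1\<close> respectively. Exchanging \<open>X\<close> and
  \<open>Y\<close> turns the second rotation into the first.\<close>

lemma germ_string_eq:
  assumes "rev_germ (rev \<alpha>)"
  shows "germ_string \<alpha> = wrap (germ_core (rev \<alpha>))"
  using assms
proof (induction \<alpha> rule: measure_induct_rule[of sum_list])
  case (less \<alpha>)
  show ?case
  proof (cases "\<forall>a\<in>set \<alpha>. a = 0")
    case True
    then have "\<alpha> = replicate (length \<alpha>) 0"
      by (simp add: replicate_length_same)
    then have "germ_core (rev \<alpha>) = (wrap ^^ length \<alpha>) [Some 0]"
      using germ_core_zeros[of "length \<alpha>" "[]"] by (metis append_Nil2 germ_core.simps(1) rev_replicate)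
    then have "wrap (germ_core (rev \<alpha>)) = (wrap ^^ Suc (length \<alpha>)) [Some 0]" by simp
    then show ?thesis
      using True unfolding wrap_funpow by (subst germ_string.simps) simp
  next
    case False
    define j where "j = length (takeWhile (\<lambda>x. x = 0) (rev \<alpha>))"
    have zeros: "takeWhile (\<lambda>x. x = 0) (rev \<alpha>) = replicate j 0"
      unfolding j_def by (rule replicate_eqI) (auto dest: set_takeWhileD)
    have "dropWhile (\<lambda>x. x = 0) (rev \<alpha>) \<noteq> []"
      using False by simp
    then obtain a as where "dropWhile (\<lambda>x. x = 0) (rev \<alpha>) = a # as"
      by (cases "dropWhile (\<lambda>x. x = 0) (rev \<alpha>)") auto
    moreover from this have "a \<noteq> 0"
      using hd_dropWhile[of "\<lambda>x. x = 0" "rev \<alpha>"] \<open>dropWhile (\<lambda>x. x = 0) (rev \<alpha>) \<noteq> []\<close> by simp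
    ultimately have rev: "rev \<alpha> = replicate j 0 @ a # as" and a: "a \<noteq> 0"
      using takeWhile_dropWhile_id[of "\<lambda>x. x = 0" "rev \<alpha>"] zeros by simp_all
    have \<alpha>: "\<alpha> = rev as @ a # replicate j 0"
      using arg_cong[OF rev, of rev] by simp
    have i: "rightmost_nonzero \<alpha> = Suc j"
      unfolding rightmost_nonzero_def
    proof (rule Least_equality)
      show "1 \<le> Suc j \<and> Suc j \<le> length \<alpha> \<and> entry \<alpha> (Suc j) \<noteq> 0"
        using a by (simp add: \<alpha> entry_def nth_append)
    next
      fix i assume i: "1 \<le> i \<and> i \<le> length \<alpha> \<and> entry \<alpha> i \<noteq> 0"
      show "Suc j \<le> i"
      proof (rule ccontr)
        assume "\<not> Suc j \<le> i"
        then have "i - 1 < j" "i - 1 < length \<alpha>" "Suc (i - 1) = i" using i by linarith+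
        then show False
          using entry_Suc[of "i - 1" \<alpha>] i by (simp add: rev nth_append)
      qed
    qed
    have beta: "beta \<alpha> = rev as @ (a - 1) # replicate j 0"
      by (simp add: beta_def i entry_def) (simp add: \<alpha> nth_append list_update_append)
    have ra: "rev_germ (a # as)" and ra': "rev_germ ((a - 1) # as)"
      using less.prems rev_germ_append unfolding rev by fastforce+
    define G where "G = germ_core ((a - 1) # as)"
    have "germ_string (beta \<alpha>) = wrap (germ_core (rev (beta \<alpha>)))"
      using less.IH[OF sum_list_beta_less[OF False]] rev_germ_zeros[OF ra'] by (simp add: beta)
    \<comment> \<open>There is one wrap for each of the \<open>j\<close> zeros and one more for the
      outer \<open>wrap\<close> in the claim.\<close>
    also have "\<dots> = (wrap ^^ Suc j) G"
      by (simp add: beta germ_core_zeros G_def)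
    finally have s: "germ_string (beta \<alpha>) =
        map Some [0..<Suc j] @ map (map_option ((+) (Suc j))) G @ replicate (Suc j) None"
      unfolding wrap_funpow .
    obtain u where u: "ballot u" "length u = 2 * length as + 1" "germ_core as = lex_labels u"
      using germ_core_ballot ra by auto
    define t where "t = False # u @ [True]"
    have t: "height t = 1" "length t = 2 * Suc (length as) + 1" "wrap (germ_core as) = lex_labels t"
      using u by (simp_all add: t_def lex_labels_wrap ballot_def)
    have "a \<le> Suc (length as)"
    proof -
      have "lex_labels u ! 0 = Some (germ_top as)"
        using germ_core_ballot[of as] ra u by (cases "lex_labels u") (auto simp flip: length_0_conv)
      then have "germ_top as = lexical_color u 0" "\<not> u ! 0"
        using u by (auto simp: nth_lex_labels split: if_splits)
      then have "germ_top as \<le> length as"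
        using lexical_color_bij_betw[of u "length as"] u unfolding bij_betw_def ballot_def by force
      then show ?thesis using ra by simp
    qed
    then have count: "count_list (wrap (germ_core as)) (Some a) = 1"
      using count_lex_labels[OF t(1,2)] t(3) by simp
    \<comment> \<open>\<open>G\<close> and \<open>wrap (germ_core as)\<close> are rotations of each
      other, so rotating either of them to \<open>a\<close> gives the same string.\<close>
    have G: "rot_to a G = germ_core (a # as)"
      using rot_to_eq_rotate[of "a - 1" "wrap (germ_core as)"] rot_to_rotate[OF count] by (auto simp: G_def)
    have G_hd: "hd G = Some (a - 1)" "G \<noteq> []"
    proof -
      obtain v where v: "G = lex_labels v" "length v = 2 * Suc (length as) + 1"
        using germ_core_ballot[OF ra'] by (auto simp: G_def simp del: germ_core.simps)
      then show "G \<noteq> []" by (auto simp flip: length_0_conv)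
      show "hd G = Some (a - 1)"
        using germ_core_ballot[OF ra'] by (simp add: G_def germ_top_def del: germ_core.simps)
    qed
    let ?XY = "map (map_option ((+) (Suc j))) G"
    \<comment> \<open>The labels of the middle part are those of \<open>G\<close> shifted by
      \<open>Suc j\<close>. Thus \<Omega> is the shifted \<open>a - 1\<close>, and \<Omega> + 1 is
      the shifted \<open>a\<close>.\<close>
    have "map_option Suc (hd ?XY) = Some (Suc j + a)"
      using G_hd a by (simp add: hd_map)
    moreover have "map_option ((+) (Suc j)) x \<noteq> Some (Suc j + a) \<longleftrightarrow> x \<noteq> Some a" for x
      by (cases x) auto
    ultimately have XY: "dropWhile (\<lambda>x. x \<noteq> map_option Suc (hd ?XY)) ?XY @
        takeWhile (\<lambda>x. x \<noteq> map_option Suc (hd ?XY)) ?XY = map (map_option ((+) (Suc j))) (germ_core (a # as))"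
      by (simp only: dropWhile_map takeWhile_map comp_def map_append rot_to_def flip: G)
    have parts: "take (Suc j) (germ_string (beta \<alpha>)) = map Some [0..<Suc j]"
      "drop (length (germ_string (beta \<alpha>)) - Suc j) (germ_string (beta \<alpha>)) = replicate (Suc j) None"
      "drop (Suc j) (take (length (germ_string (beta \<alpha>)) - Suc j) (germ_string (beta \<alpha>))) = ?XY"
      unfolding s by simp_all
    have "germ_string \<alpha> = map Some [0..<Suc j] @ (dropWhile (\<lambda>x. x \<noteq> map_option Suc (hd ?XY)) ?XY @
        takeWhile (\<lambda>x. x \<noteq> map_option Suc (hd ?XY)) ?XY) @ replicate (Suc j) None"
      by (subst germ_string.simps) (simp only: Let_def i parts False if_False append_assoc)
    also have "\<dots> = (wrap ^^ Suc j) (germ_core (a # as))"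
      unfolding XY wrap_funpow ..
    also have "\<dots> = wrap (germ_core (rev \<alpha>))"
      by (simp add: rev germ_core_zeros del: germ_core.simps)
    finally show ?thesis .
  qed
qed

section \<open>Index conditions for germs and the germ of a label string\<close>

lemma rev_germ_iff:
  "rev_germ as \<longleftrightarrow> (as \<noteq> [] \<longrightarrow> last as \<le> 1) \<and> (\<forall>i. Suc i < length as \<longrightarrow> as ! i \<le> Suc (as ! Suc i))"
proof (induction as)
  case (Cons a as)
  show ?case
  proof (cases as)
    case (Cons b bs)
    have "(\<forall>i. Suc i < length (a # as) \<longrightarrow> (a # as) ! i \<le> Suc ((a # as) ! Suc i)) \<longleftrightarrow>
      a \<le> Suc b \<and> (\<forall>i. Suc i < length as \<longrightarrow> as ! i \<le> Suc (as ! Suc i))"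
    proof -
      have "(\<forall>i. Q i) \<longleftrightarrow> Q 0 \<and> (\<forall>i. Q (Suc i))" for Q :: "nat \<Rightarrow> bool"
        by (metis not0_implies_Suc)
      from this[of "\<lambda>i. Suc i < length (a # as) \<longrightarrow> (a # as) ! i \<le> Suc ((a # as) ! Suc i)"]
      show ?thesis using Cons by simp
    qed
    then show ?thesis using Cons.IH Cons by (auto simp: germ_top_def)
  qed (simp add: germ_top_def)
qed simp

lemma germ_iff_rev_germ:
  assumes "1 < k"
  shows "germ k \<alpha> \<longleftrightarrow> length \<alpha> = k - 1 \<and> rev_germ (rev \<alpha>)"
proof (cases "length \<alpha> = k - 1")
  case True
  have "entry \<alpha> (k - 1) = last (rev \<alpha>)" "rev \<alpha> \<noteq> []"
    using True assms by (auto simp: entry_def last_rev hd_conv_nth simp flip: length_0_conv)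
  moreover have "(\<forall>i. 1 < i \<and> i < k \<longrightarrow> entry \<alpha> (i - 1) \<le> entry \<alpha> i + 1) \<longleftrightarrow>
    (\<forall>i. Suc i < length (rev \<alpha>) \<longrightarrow> rev \<alpha> ! i \<le> Suc (rev \<alpha> ! Suc i))" (is "?L \<longleftrightarrow> ?R")
  proof
    assume L: ?L
    show ?R
    proof (intro allI impI)
      fix i assume "Suc i < length (rev \<alpha>)"
      then show "rev \<alpha> ! i \<le> Suc (rev \<alpha> ! Suc i)"
        using L[rule_format, of "Suc (Suc i)"] True by (simp add: entry_Suc)
    qed
  next
    assume R: ?R
    show ?L
    proof (intro allI impI)
      fix i assume i: "1 < i \<and> i < k"
      \<comment> \<open>\<open>entry\<close> counts from 1, so the entries with indices
        \<open>i - 1\<close> and \<open>i\<close> stand at positions \<open>i - 2\<close> and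
        \<open>i - 1\<close> of the reversed list.\<close>
      define j where "j = i - 2"
      have "i = Suc (Suc j)" using i unfolding j_def by linarith
      then show "entry \<alpha> (i - 1) \<le> entry \<alpha> i + 1"
        using R[rule_format, of j] i True by (simp add: entry_Suc)
    qed
  qed
  ultimately show ?thesis
    using True by (auto simp: germ_def rev_germ_iff)
qed (simp add: germ_def)

text \<open>Rotated to its label 0, \<open>b\<close> becomes \<open>False # u @ [True]\<close> with
  a ballot string \<open>u\<close>. Since \<open>wrap\<close> is injective, a germ fits iff its core
  is the label string of \<open>u\<close>; \<open>ballot_imp_germ_core\<close> gives existence and
  \<open>germ_core_inj\<close> uniqueness.\<close>

lemma ex1_germ:
  assumes "1 < k" "height b = 1" "length b = 2 * k + 1"
  shows "\<exists>!\<alpha>. germ k \<alpha> \<and> from_zero (germ_string \<alpha>) = from_zero (lex_labels b)"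
proof -
  have "length b = 2 * (k - 1) + 3" using assms by linarith
  then obtain j u where u: "ballot u" and j: "rotate j b = False # u @ [True]"
    using rotation_decomp[of b "k - 1"] assms(2) by blast
  have len: "length u = 2 * (k - 1) + 1"
    using arg_cong[OF j, of length] assms by simp
  have "from_zero (lex_labels b) = rot_to 0 (lex_labels (rotate j b))"
    using rot_to_rotate[OF count_lex_labels[OF assms(2,3)], of 0 j] assms(2) by (simp add: from_zero_eq lex_labels_rotate)
  also have "\<dots> = wrap (lex_labels u)"
    unfolding j lex_labels_wrap[OF u] by (simp add: wrap_def)
  finally have b: "from_zero (lex_labels b) = wrap (lex_labels u)" .
  \<comment> \<open>The string of a germ is a wrapped one and begins with the label 0, so
    \<open>from_zero\<close> fixes it.\<close>
  have F: "from_zero (germ_string \<alpha>) = wrap (germ_core (rev \<alpha>))" if "germ k \<alpha>" for \<alpha>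
    using that germ_string_eq[of \<alpha>] assms(1) by (simp add: germ_iff_rev_germ from_zero_eq wrap_def)
  obtain as where as: "rev_germ as" "length as = k - 1" "germ_core as = lex_labels u"
    using ballot_imp_germ_core[OF u len] by blast
  show ?thesis
  proof (intro ex1I[of _ "rev as"])
    show "germ k (rev as) \<and> from_zero (germ_string (rev as)) = from_zero (lex_labels b)"
      using as assms(1) F[of "rev as"] b by (simp add: germ_iff_rev_germ)
  next
    fix \<alpha> assume \<alpha>: "germ k \<alpha> \<and> from_zero (germ_string \<alpha>) = from_zero (lex_labels b)"
    then have "germ_core (rev \<alpha>) = germ_core as"
      using F[of \<alpha>] b as(3) by (auto dest: wrap_inj)
    then have "rev \<alpha> = as"
      using \<alpha> as assms(1) by (intro germ_core_inj) (auto simp: germ_iff_rev_germ)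
    then show "\<alpha> = rev as" by auto
  qed
qed

section \<open>1-factorizations\<close>

lemma level_lower_iff: "b \<in> level k k \<longleftrightarrow> length b = 2 * k + 1 \<and> height b = 1"
  by (auto simp: level_def height_eq_count)

lemma level_upper_iff: "b \<in> level k (Suc k) \<longleftrightarrow> length b = 2 * k + 1 \<and> height b = - 1"
  by (auto simp: level_def height_eq_count)

lemmas level_iff = level_lower_iff level_upper_iff

lemma height_update: "x < length b \<Longrightarrow> \<not> b ! x \<Longrightarrow> height (b[x := True]) = height b - 2"
  by (induction b arbitrary: x) (auto simp: nth_Cons split: nat.splits)

lemma aleph_aleph [simp]: "aleph (aleph b) = b"
  by (simp add: aleph_def rev_map comp_def)

lemma verts_middle_graph: "verts (middle_graph k) = {b. length b = 2 * k + 1 \<and> (height b = 1 \<or> height b = - 1)}"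
  by (auto simp: middle_graph_def level_iff)

section \<open>Edges of M_k and their symmetries\<close>

text \<open>Coordinates for the edges of M_k: the lower end and the position that changes.\<close>

definition raisable :: "nat \<Rightarrow> bstring \<Rightarrow> nat \<Rightarrow> bool" where
  "raisable k b x \<longleftrightarrow> length b = 2 * k + 1 \<and> height b = 1 \<and> x < length b \<and> \<not> b ! x"

text \<open>The end with a 0 at the differing position is the lower one, because raising this entry
  lowers the height by 2, from 1 to -1.\<close>

lemma middle_edge_iff:
  "e \<in> edges (middle_graph k) \<longleftrightarrow> (\<exists>b x. raisable k b x \<and> e = {b, b[x := True]})"
proof
  assume "e \<in> edges (middle_graph k)"
  then obtain b c where e: "e = {b, c}" and bc: "b \<in> verts (middle_graph k)" "c \<in> verts (middle_graph k)"
    and "card {i. i < 2 * k + 1 \<and> b ! i \<noteq> c ! i} = 1"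
    by (auto simp: middle_graph_def)
  then obtain x where x: "{i. i < 2 * k + 1 \<and> b ! i \<noteq> c ! i} = {x}"
    by (auto simp: card_1_singleton_iff)
  have len: "length b = 2 * k + 1" "length c = 2 * k + 1" using bc by (auto simp: verts_middle_graph)
  have x': "x < 2 * k + 1" "b ! x \<noteq> c ! x" using x by blast+
  have eq: "b ! i = c ! i" if "i < 2 * k + 1" "i \<noteq> x" for i using x that by blast
  show "\<exists>b x. raisable k b x \<and> e = {b, b[x := True]}"
  proof (cases "b ! x")
    case False
    have "c = b[x := True]"
      using len x' False eq by (intro nth_equalityI) (auto simp: nth_list_update)
    moreover from this have "raisable k b x"
      using bc len x' False height_update[of x b] by (auto simp: raisable_def verts_middle_graph)
    ultimately show ?thesis using e by blast
  next
    case True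
    have "b = c[x := True]"
      using len x' True eq by (intro nth_equalityI) (auto simp: nth_list_update)
    moreover from this have "raisable k c x"
      using bc len x' True height_update[of x c] by (auto simp: raisable_def verts_middle_graph)
    ultimately show ?thesis using e by blast
  qed
next
  assume "\<exists>b x. raisable k b x \<and> e = {b, b[x := True]}"
  then obtain b x where b: "raisable k b x" and e: "e = {b, b[x := True]}" by blast
  have "{i. i < 2 * k + 1 \<and> b ! i \<noteq> b[x := True] ! i} = {x}"
    using b by (auto simp: raisable_def nth_list_update)
  then have "card {i. i < 2 * k + 1 \<and> b ! i \<noteq> b[x := True] ! i} = 1" by simp
  moreover have "b \<in> level k k" "b[x := True] \<in> level k (k + 1)"
    using b height_update[of x b] by (simp_all add: raisable_def level_iff)
  ultimately show "e \<in> edges (middle_graph k)"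
    unfolding e middle_graph_def by auto
qed

text \<open>The heights 1 and -1 tell the ends apart, so the edge determines its lower end and the
  changed position, and the definite description has a unique solution.\<close>

lemma lexical_edge_color_eq:
  assumes "raisable k b x"
  shows "lexical_edge_color k {b, b[x := True]} = lexical_color b x"
  unfolding lexical_edge_color_def
proof (rule the_equality)
  show "\<exists>b' x'. b' \<in> level k k \<and> x' < 2 * k + 1 \<and> \<not> b' ! x' \<and>
      {b, b[x := True]} = {b', b'[x' := True]} \<and> lexical_color b x = lexical_color b' x'"
    using assms unfolding raisable_def level_lower_iff by metis
next
  fix c assume "\<exists>b' x'. b' \<in> level k k \<and> x' < 2 * k + 1 \<and> \<not> b' ! x' \<and>
      {b, b[x := True]} = {b', b'[x' := True]} \<and> c = lexical_color b' x'"
  then obtain b' x' where "b' \<in> level k k" "x' < 2 * k + 1" "\<not> b' ! x'"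
    and eq: "{b, b[x := True]} = {b', b'[x' := True]}" and c: "c = lexical_color b' x'"
    by blast
  then have b': "raisable k b' x'" by (simp add: raisable_def level_lower_iff)
  have "height (b[x := True]) = - 1" "height b = 1" "height (b'[x' := True]) = - 1" "height b' = 1"
    using assms b' by (simp_all add: raisable_def height_update)
  then have "b = b'" "b[x := True] = b'[x' := True]"
    using eq by (auto simp: doubleton_eq_iff)
  moreover from this have "x = x'"
    using assms b' by (metis nth_list_update_eq nth_list_update_neq raisable_def)
  ultimately show "c = lexical_color b x" using c by simp
qed

lemma raisable_rotate:
  assumes "raisable k b x"
  shows "\<exists>y. raisable k (rotate j b) y \<and> rotate j (b[x := True]) = (rotate j b)[y := True] \<and>
    lexical_color (rotate j b) y = lexical_color b x"
proof (induction j)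
  case 0
  then show ?case using assms by auto
next
  case (Suc j)
  have step: "\<exists>y. raisable k (rotate1 b) y \<and> rotate1 (b[x := True]) = (rotate1 b)[y := True] \<and>
    lexical_color (rotate1 b) y = lexical_color b x" if b: "raisable k b x" for b x
  proof -
    obtain c b' where c: "b = c # b'" using b by (cases b) (auto simp: raisable_def)
    \<comment> \<open>The position of entry \<open>x\<close> after one rotation to the left; the
      first entry goes to the end.\<close>
    define y where "y = (case x of 0 \<Rightarrow> length b' | Suc z \<Rightarrow> z)"
    have y: "y < length b" "Suc y mod length b = x"
      using b by (auto simp: y_def c raisable_def split: nat.splits)
    have "rotate1 (b[x := True]) = (rotate1 b)[y := True]"
      using b by (auto simp: c y_def raisable_def list_update_append split: nat.splits)
    moreover have "raisable k (rotate1 b) y"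
      using b y height_rotate[of 1 b] nth_rotate1[of y b] by (simp add: raisable_def)
    moreover have "lexical_color (rotate1 b) y = lexical_color b x"
      using lexical_color_rotate1[of b y] b y by (simp add: raisable_def)
    ultimately show ?thesis by blast
  qed
  obtain y where y: "raisable k (rotate j b) y" "rotate j (b[x := True]) = (rotate j b)[y := True]"
    "lexical_color (rotate j b) y = lexical_color b x"
    using Suc by blast
  with step[OF y(1)] show ?case by simp
qed

lemma middle_edge_rotate:
  assumes "e \<in> edges (middle_graph k)"
  shows "rotate j ` e \<in> edges (middle_graph k) \<and>
    lexical_edge_color k (rotate j ` e) = lexical_edge_color k e"
proof -
  obtain b x where b: "raisable k b x" and e: "e = {b, b[x := True]}"
    using assms middle_edge_iff by blast
  obtain y where y: "raisable k (rotate j b) y" "rotate j (b[x := True]) = (rotate j b)[y := True]"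
    "lexical_color (rotate j b) y = lexical_color b x"
    using raisable_rotate[OF b] by blast
  have "rotate j ` e = {rotate j b, (rotate j b)[y := True]}" by (simp add: e y)
  then show ?thesis
    using y b lexical_edge_color_eq middle_edge_iff e by metis
qed

text \<open>Complemented reversal swaps the two levels: the lower end of the mirrored edge is the
  mirror image of the upper end, with the changed position counted from the other side.\<close>

lemma middle_edge_aleph:
  assumes "e \<in> edges (middle_graph k)"
  shows "aleph ` e \<in> edges (middle_graph k) \<and>
    lexical_edge_color k (aleph ` e) = lexical_edge_color k e"
proof -
  obtain b x where b: "raisable k b x" and e: "e = {b, b[x := True]}"
    using assms middle_edge_iff by blast
  let ?c = "aleph (b[x := True])" and ?y = "length b - 1 - x"
  have "aleph b = ?c[?y := True]"
    using b by (intro nth_equalityI) (auto simp: aleph_def nth_list_update rev_nth raisable_def)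
  then have img: "aleph ` e = {?c, ?c[?y := True]}" by (auto simp: e)
  have "\<not> ?c ! ?y" using b by (simp add: aleph_def rev_nth raisable_def)
  then have c: "raisable k ?c ?y"
    using b by (auto simp: raisable_def height_aleph height_update)
  then show ?thesis
    using img e b lexical_edge_color_eq middle_edge_iff lexical_color_aleph
    by (metis raisable_def)
qed

lemma middle_edge_length: "e \<in> edges (middle_graph k) \<Longrightarrow> b \<in> e \<Longrightarrow> length b = 2 * k + 1"
  by (auto simp: middle_edge_iff raisable_def)

lemma lexical_edge_color_le: "e \<in> edges (middle_graph k) \<Longrightarrow> lexical_edge_color k e \<le> k"
  using lexical_color_bij_betw by (fastforce simp: middle_edge_iff raisable_def lexical_edge_color_eq bij_betw_def)

lemma middle_ex1_lower:
  assumes "length b = 2 * k + 1" "height b = 1" "i \<le> k"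
  shows "\<exists>!e. e \<in> edges (middle_graph k) \<and> b \<in> e \<and> lexical_edge_color k e = i"
proof -
  have bij: "bij_betw (lexical_color b) {x. x < length b \<and> \<not> b ! x} {0..k}"
    using assms by (intro lexical_color_bij_betw)
  have "i \<in> lexical_color b ` {x. x < length b \<and> \<not> b ! x}"
    using bij assms(3) by (simp add: bij_betw_def)
  then obtain x where x: "raisable k b x" "lexical_color b x = i"
    using assms by (auto simp: raisable_def)
  show ?thesis
  proof (intro ex1I[of _ "{b, b[x := True]}"])
    show "{b, b[x := True]} \<in> edges (middle_graph k) \<and> b \<in> {b, b[x := True]} \<and>
        lexical_edge_color k {b, b[x := True]} = i"
      using x lexical_edge_color_eq[OF x(1)] by (auto simp: middle_edge_iff)
  next
    fix e assume e: "e \<in> edges (middle_graph k) \<and> b \<in> e \<and> lexical_edge_color k e = i"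
    then obtain c y where c: "raisable k c y" "e = {c, c[y := True]}"
      by (auto simp: middle_edge_iff)
    \<comment> \<open>Since \<open>b\<close> has height 1, it can only be the lower end of an
      edge.\<close>
    moreover from c(1) have "height (c[y := True]) = - 1"
      by (simp add: raisable_def height_update)
    ultimately have bc: "c = b" using e assms(2) by auto
    then have "lexical_color b y = i" using e c lexical_edge_color_eq by auto
    then have "y = x"
      using bij x c(1) bc by (auto simp: bij_betw_def raisable_def dest: inj_onD)
    then show "e = {b, b[x := True]}" using c bc by simp
  qed
qed

text \<open>An upper vertex \<open>b\<close> is carried to the lower vertex \<open>aleph b\<close>
  by an involution that preserves edges and colors.\<close>

lemma middle_ex1:
  assumes "b \<in> verts (middle_graph k)" "i \<le> k"
  shows "\<exists>!e. e \<in> edges (middle_graph k) \<and> b \<in> e \<and> lexical_edge_color k e = i"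
proof (cases "height b = 1")
  case True
  then show ?thesis using assms middle_ex1_lower by (simp add: verts_middle_graph)
next
  case False
  then have "\<exists>!e. e \<in> edges (middle_graph k) \<and> aleph b \<in> e \<and> lexical_edge_color k e = i"
    using assms by (intro middle_ex1_lower) (auto simp: verts_middle_graph height_aleph)
  then obtain e where e: "e \<in> edges (middle_graph k)" "aleph b \<in> e" "lexical_edge_color k e = i"
    and uniq: "\<And>f. f \<in> edges (middle_graph k) \<Longrightarrow> aleph b \<in> f \<Longrightarrow> lexical_edge_color k f = i \<Longrightarrow> f = e"
    by blast
  show ?thesis
  proof (intro ex1I[of _ "aleph ` e"])
    show "aleph ` e \<in> edges (middle_graph k) \<and> b \<in> aleph ` e \<and> lexical_edge_color k (aleph ` e) = i"
      using e middle_edge_aleph[OF e(1)] by (metis aleph_aleph image_eqI)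
  next
    fix f assume f: "f \<in> edges (middle_graph k) \<and> b \<in> f \<and> lexical_edge_color k f = i"
    then have "aleph ` f = e"
      using middle_edge_aleph[of f k] by (intro uniq) auto
    then show "f = aleph ` e" by (auto simp: image_image)
  qed
qed

section \<open>Translation classes and the coloring of M_k/\<pi>\<close>

lemma vertex_class_rotate [simp]: "vertex_class (rotate j b) = vertex_class b"
proof
  show "vertex_class (rotate j b) \<subseteq> vertex_class b"
    by (auto simp: vertex_class_def rotate_rotate)
  have "rotate i b = rotate (i + (j * length b - j)) (rotate j b)" for i
    using arg_cong[OF rotate_inverse[of j b], of "rotate i"] by (simp only: rotate_rotate add.assoc)
  then show "vertex_class b \<subseteq> vertex_class (rotate j b)"
    unfolding vertex_class_def by (intro image_subsetI range_eqI)
qed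

lemma vertex_class_self: "b \<in> vertex_class b"
  using rangeI[of "\<lambda>j. rotate j b" 0] by (simp add: vertex_class_def)

lemma vertex_class_eqD: "vertex_class b = vertex_class c \<Longrightarrow> \<exists>j. b = rotate j c"
  using vertex_class_self[of b] by (auto simp: vertex_class_def)

lemma edge_class_rotate:
  assumes "\<And>b. b \<in> e \<Longrightarrow> length b = n"
  shows "edge_class (rotate j ` e) = edge_class e"
proof
  show "edge_class (rotate j ` e) \<subseteq> edge_class e"
    by (auto simp: edge_class_def image_image rotate_rotate)
  have "rotate i b = rotate (i + (j * n - j)) (rotate j b)" if "b \<in> e" for i b
    using arg_cong[OF rotate_inverse[of j b], of "rotate i"] assms[OF that]
    by (simp only: rotate_rotate add.assoc)
  then have "rotate i ` e = rotate (i + (j * n - j)) ` rotate j ` e" for i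
    unfolding image_image by (intro image_cong refl)
  then show "edge_class e \<subseteq> edge_class (rotate j ` e)"
    unfolding edge_class_def by (intro image_subsetI range_eqI)
qed

text \<open>Reversal turns a rotation by \<open>j\<close> into the inverse rotation.\<close>

lemma aleph_rotate: "aleph (rotate j b) = rotate (j * length b - j) (aleph b)"
proof -
  have 1: "rotate1 (aleph (rotate1 c)) = aleph c" for c
    by (cases c) (auto simp: aleph_def)
  have "rotate j (aleph (rotate j b)) = aleph b"
  proof (induction j)
    case (Suc j)
    have "rotate (Suc j) (aleph (rotate (Suc j) b)) = rotate j (rotate1 (aleph (rotate1 (rotate j b))))"
      by (simp add: rotate1_rotate_swap)
    then show ?case by (simp only: 1 Suc)
  qed simp
  then show ?thesis
    using rotate_inverse[of j "aleph (rotate j b)"] by simp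
qed

lemma quotient_edge_mem:
  assumes "E \<in> edges (quotient_graph k)" "e \<in> E"
  shows "e \<in> edges (middle_graph k)" "E = edge_class e"
proof -
  obtain f where f: "f \<in> edges (middle_graph k)" "E = edge_class f"
    using assms by (auto simp: quotient_graph_def)
  then obtain j where "e = rotate j ` f" using assms(2) by (auto simp: edge_class_def)
  then show "e \<in> edges (middle_graph k)" "E = edge_class e"
    using f middle_edge_rotate[OF f(1)] edge_class_rotate[of f "2 * k + 1"] middle_edge_length[OF f(1)]
    by auto
qed

lemma edge_class_self: "e \<in> edge_class e"
  using rangeI[of "\<lambda>j. rotate j ` e" 0] by (simp add: edge_class_def)

lemma common_value_eq: "x \<in> A \<Longrightarrow> (\<And>y. y \<in> A \<Longrightarrow> f y = c) \<Longrightarrow> common_value f A = c"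
  unfolding common_value_def by (rule the_equality) auto

text \<open>Translation invariance of the lexical color makes the common value well defined.\<close>

lemma quotient_color_eq:
  assumes "E \<in> edges (quotient_graph k)" "e \<in> E"
  shows "quotient_color k E = lexical_edge_color k e"
  unfolding quotient_color_def
proof (rule common_value_eq)
  fix f assume "f \<in> E"
  then obtain j where "f = rotate j ` e"
    using quotient_edge_mem[OF assms] by (auto simp: edge_class_def)
  then show "lexical_edge_color k f = lexical_edge_color k e"
    using middle_edge_rotate quotient_edge_mem[OF assms] by simp
qed (rule assms)

lemma edge_class_in_quotient: "e \<in> edges (middle_graph k) \<Longrightarrow> edge_class e \<in> edges (quotient_graph k)"
  by (simp add: quotient_graph_def)

lemma quotient_edge_nonempty: "E \<in> edges (quotient_graph k) \<Longrightarrow> \<exists>e. e \<in> E"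
  using edge_class_self by (auto simp: quotient_graph_def)

lemma quotient_color_le: "E \<in> edges (quotient_graph k) \<Longrightarrow> quotient_color k E \<le> k"
  using quotient_edge_nonempty quotient_color_eq lexical_edge_color_le quotient_edge_mem by metis

lemma ends_quotient_graph: "ends (quotient_graph k) E = (\<Union>e\<in>E. vertex_class ` e)"
  by (simp add: quotient_graph_def middle_graph_def)

text \<open>Existence descends from M_k. For uniqueness, a member of any other candidate class is
  translated until it contains the chosen representative \<open>b\<close>, where the edge of color
  \<open>i\<close> is unique.\<close>

lemma quotient_ex1:
  assumes "v \<in> verts (quotient_graph k)" "i \<le> k"
  shows "\<exists>!E. E \<in> edges (quotient_graph k) \<and> v \<in> ends (quotient_graph k) E \<and> quotient_color k E = i"
proof -
  obtain b where b: "b \<in> verts (middle_graph k)" "v = vertex_class b"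
    using assms(1) by (auto simp: quotient_graph_def)
  then obtain e where e: "e \<in> edges (middle_graph k)" "b \<in> e" "lexical_edge_color k e = i"
    and uniq: "\<And>f. f \<in> edges (middle_graph k) \<Longrightarrow> b \<in> f \<Longrightarrow> lexical_edge_color k f = i \<Longrightarrow> f = e"
    using middle_ex1[OF b(1) assms(2)] by blast
  show ?thesis
  proof (intro ex1I[of _ "edge_class e"])
    show "edge_class e \<in> edges (quotient_graph k) \<and> v \<in> ends (quotient_graph k) (edge_class e) \<and>
        quotient_color k (edge_class e) = i"
      using e b edge_class_in_quotient[OF e(1)] edge_class_self[of e] quotient_color_eq
      by (fastforce simp: ends_quotient_graph)
  next
    fix E assume E: "E \<in> edges (quotient_graph k) \<and> v \<in> ends (quotient_graph k) E \<and> quotient_color k E = i"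
    then obtain f c where f: "f \<in> E" "c \<in> f" "v = vertex_class c"
      by (auto simp: ends_quotient_graph)
    then obtain j where j: "b = rotate j c" using b(2) vertex_class_eqD by metis
    have "rotate j ` f \<in> E"
      using quotient_edge_mem[of E k f] E f(1) by (auto simp: edge_class_def)
    moreover from this have "rotate j ` f = e"
      using E f(2) j quotient_edge_mem[of E k "rotate j ` f"] quotient_color_eq[of E k "rotate j ` f"]
      by (intro uniq) auto
    ultimately show "E = edge_class e"
      using quotient_edge_mem(2) E by blast
  qed
qed

section \<open>Complemented reversal on M_k/\<pi>\<close>

text \<open>One inclusion follows from \<open>aleph_rotate\<close>; the other is the same inclusion
  for \<open>aleph b\<close>, as \<open>aleph\<close> is an involution.\<close>

lemma aleph_vertex_class: "aleph_vertex (vertex_class b) = vertex_class (aleph b)"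
proof
  have sub: "aleph_vertex (vertex_class b) \<subseteq> vertex_class (aleph b)" for b
    by (auto simp: aleph_vertex_def vertex_class_def aleph_rotate)
  then show "aleph_vertex (vertex_class b) \<subseteq> vertex_class (aleph b)" .
  show "vertex_class (aleph b) \<subseteq> aleph_vertex (vertex_class b)"
  proof
    fix c assume "c \<in> vertex_class (aleph b)"
    then have "aleph c \<in> vertex_class b"
      using sub[of "aleph b"] by (auto simp: aleph_vertex_def)
    then show "c \<in> aleph_vertex (vertex_class b)"
      unfolding aleph_vertex_def by (metis aleph_aleph imageI)
  qed
qed

lemma aleph_edge_class:
  assumes "\<And>b. b \<in> e \<Longrightarrow> length b = n"
  shows "aleph_edge (edge_class e) = edge_class (aleph ` e)"
proof
  have sub: "aleph_edge (edge_class e) \<subseteq> edge_class (aleph ` e)" if len: "\<And>b. b \<in> e \<Longrightarrow> length b = n" for e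
  proof -
    have "aleph ` rotate j ` e = rotate (j * n - j) ` aleph ` e" for j
      using len by (auto simp: image_image aleph_rotate intro!: image_cong)
    then show ?thesis by (auto simp: aleph_edge_def edge_class_def)
  qed
  show "aleph_edge (edge_class e) \<subseteq> edge_class (aleph ` e)"
    using assms by (rule sub)
  have inv: "aleph ` aleph ` f = f" for f by (simp add: image_image)
  have mirror: "aleph_edge (edge_class (aleph ` e)) \<subseteq> edge_class e"
    using sub[of "aleph ` e", unfolded inv] assms by force
  show "edge_class (aleph ` e) \<subseteq> aleph_edge (edge_class e)"
  proof
    fix f assume "f \<in> edge_class (aleph ` e)"
    then have "aleph ` f \<in> edge_class e"
      using mirror by (auto simp: aleph_edge_def)
    then show "f \<in> aleph_edge (edge_class e)"
      unfolding aleph_edge_def using inv[of f] by (metis imageI)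
  qed
qed

lemma aleph_edge_involutive [simp]: "aleph_edge (aleph_edge E) = E"
  by (simp add: aleph_edge_def image_image)

lemma aleph_vertex_involutive [simp]: "aleph_vertex (aleph_vertex v) = v"
  by (simp add: aleph_vertex_def image_image)

lemma quotient_edge_aleph:
  assumes "E \<in> edges (quotient_graph k)"
  shows "aleph_edge E \<in> edges (quotient_graph k)" "quotient_color k (aleph_edge E) = quotient_color k E"
    "ends (quotient_graph k) (aleph_edge E) = aleph_vertex ` ends (quotient_graph k) E"
proof -
  obtain e where e: "e \<in> E" using quotient_edge_nonempty[OF assms] by blast
  note e' = quotient_edge_mem[OF assms e]
  have "aleph_edge E = edge_class (aleph ` e)"
    using aleph_edge_class[of e "2 * k + 1"] middle_edge_length[OF e'(1)] e'(2) by simp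
  then show E': "aleph_edge E \<in> edges (quotient_graph k)"
    using edge_class_in_quotient middle_edge_aleph[OF e'(1)] by simp
  have "aleph ` e \<in> aleph_edge E" using e by (simp add: aleph_edge_def)
  then show "quotient_color k (aleph_edge E) = quotient_color k E"
    using quotient_color_eq[OF E'] quotient_color_eq[OF assms e] middle_edge_aleph[OF e'(1)] by simp
  show "ends (quotient_graph k) (aleph_edge E) = aleph_vertex ` ends (quotient_graph k) E"
    by (simp add: ends_quotient_graph aleph_edge_def image_UN image_image aleph_vertex_class)
qed

text \<open>Both \<open>E\<close> and its mirror image join \<open>v\<close> to its mirror image, and they have the same color.\<close>

lemma horizontal_imp_fixed:
  assumes "horizontal k E"
  shows "aleph_edge E = E"
proof -
  obtain v where v: "v \<in> verts (quotient_graph k)" "ends (quotient_graph k) E = {v, aleph_vertex v}"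
    and E: "E \<in> edges (quotient_graph k)"
    using assms by (auto simp: horizontal_def)
  have "v \<in> ends (quotient_graph k) (aleph_edge E)"
    using quotient_edge_aleph(3)[OF E] v(2) by simp
  then show ?thesis
    using quotient_ex1[OF v(1) quotient_color_le[OF E]] quotient_edge_aleph[OF E] E v(2) by blast
qed

section \<open>The coloring of R_k\<close>

text \<open>A horizontal edge is fixed by \<open>aleph_edge\<close>, so its singleton also has the
  form \<open>{E, aleph_edge E}\<close>; this gives loops and skew pairs one common
  description.\<close>

lemma edges_folded_graph:
  "edges (folded_graph k) = (\<lambda>E. {E, aleph_edge E}) ` edges (quotient_graph k)"
proof -
  have "edges (folded_graph k) = {{E, aleph_edge E} | E. skew k E} \<union> {{E, aleph_edge E} | E. horizontal k E}"
    using horizontal_imp_fixed by (auto simp: folded_graph_def)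
  then show ?thesis by (auto simp: skew_def horizontal_def)
qed

lemma collapsed_color_eq:
  assumes "E \<in> edges (quotient_graph k)"
  shows "collapsed_color k {E, aleph_edge E} = quotient_color k E"
  unfolding collapsed_color_def
  using quotient_edge_aleph(2)[OF assms] by (intro common_value_eq[of E]) auto

lemma ends_folded_graph:
  assumes "E \<in> edges (quotient_graph k)"
  shows "ends (folded_graph k) {E, aleph_edge E} = vertex_pair ` ends (quotient_graph k) E"
proof -
  have "vertex_pair (aleph_vertex v) = vertex_pair v" for v
    by (auto simp: vertex_pair_def)
  then have "vertex_pair ` ends (quotient_graph k) (aleph_edge E) = vertex_pair ` ends (quotient_graph k) E"
    by (simp add: quotient_edge_aleph[OF assms] image_image)
  then show ?thesis by (simp add: folded_graph_def)
qed

text \<open>An edge of R_k at the pair of \<open>v\<close> comes from an edge of M_k/\<pi> at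
  \<open>v\<close> or at its mirror image. In the second case the mirrored edge is at
  \<open>v\<close>, has the same color and yields the same pair, so uniqueness at \<open>v\<close>
  decides.\<close>

lemma folded_ex1:
  assumes "V \<in> verts (folded_graph k)" "i \<le> k"
  shows "\<exists>!Q. Q \<in> edges (folded_graph k) \<and> V \<in> ends (folded_graph k) Q \<and> collapsed_color k Q = i"
proof -
  obtain v where V: "V = vertex_pair v" and v: "v \<in> verts (quotient_graph k)"
    using assms(1) by (auto simp: folded_graph_def quotient_graph_def middle_graph_def)
  obtain E where E: "E \<in> edges (quotient_graph k)" "v \<in> ends (quotient_graph k) E" "quotient_color k E = i"
    and uniq: "\<And>E'. E' \<in> edges (quotient_graph k) \<Longrightarrow> v \<in> ends (quotient_graph k) E' \<Longrightarrow>
      quotient_color k E' = i \<Longrightarrow> E' = E"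
    using quotient_ex1[OF v assms(2)] by blast
  show ?thesis
  proof (intro ex1I[of _ "{E, aleph_edge E}"])
    show "{E, aleph_edge E} \<in> edges (folded_graph k) \<and> V \<in> ends (folded_graph k) {E, aleph_edge E} \<and>
        collapsed_color k {E, aleph_edge E} = i"
      using E V by (auto simp: edges_folded_graph ends_folded_graph collapsed_color_eq)
  next
    fix Q assume Q: "Q \<in> edges (folded_graph k) \<and> V \<in> ends (folded_graph k) Q \<and> collapsed_color k Q = i"
    then obtain E' where E': "E' \<in> edges (quotient_graph k)" "Q = {E', aleph_edge E'}"
      by (auto simp: edges_folded_graph)
    then obtain v' where v': "v' \<in> ends (quotient_graph k) E'" "vertex_pair v' = vertex_pair v"
      using Q V by (auto simp: ends_folded_graph)
    have col: "quotient_color k E' = i" using Q E' by (simp add: collapsed_color_eq)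
    from v'(2) consider "v' = v" | "v' = aleph_vertex v"
      by (auto simp: vertex_pair_def doubleton_eq_iff)
    then show "Q = {E, aleph_edge E}"
    proof cases
      case 1
      then have "E' = E" using uniq E'(1) v'(1) col by blast
      then show ?thesis using E' by simp
    next
      case 2
      then have "v \<in> ends (quotient_graph k) (aleph_edge E')"
        using quotient_edge_aleph(3)[OF E'(1)] v'(1) by (metis aleph_vertex_involutive image_eqI)
      then have "aleph_edge E' = E"
        using uniq quotient_edge_aleph[OF E'(1)] col by simp
      then show ?thesis using E'(2) by auto
    qed
  qed
qed

section \<open>Label strings of the vertices of R_k\<close>

lemma labels_eq_lex_labels:
  assumes "b \<in> level k k"
  shows "labels k b = lex_labels b"
  using assms lexical_edge_color_eq
  by (auto simp: labels_def lex_labels_def level_lower_iff raisable_def simp del: upt_Suc)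

text \<open>Of the two classes in the pair only that of \<open>b\<close> has height 1. Its members
  have label strings that are rotations of each other with a single label 0, so
  \<open>from_zero\<close> agrees on them and \<open>delta\<close> is well defined.\<close>

lemma delta_vertex_pair:
  assumes "b \<in> level k k"
  shows "\<Union>(vertex_pair (vertex_class b)) \<inter> level k k = vertex_class b"
    and "c \<in> vertex_class b \<Longrightarrow> from_zero (labels k c) = from_zero (lex_labels b)"
    and "delta k (vertex_pair (vertex_class b)) = from_zero (lex_labels b)"
proof -
  have b: "length b = 2 * k + 1" "height b = 1" using assms by (simp_all add: level_lower_iff)
  show V: "\<Union>(vertex_pair (vertex_class b)) \<inter> level k k = vertex_class b"
  proof -
    have class_ht: "height c = height a \<and> length c = length a" if "c \<in> vertex_class a" for a c
      using that by (auto simp: vertex_class_def)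
    then have "vertex_class b \<subseteq> level k k" "vertex_class (aleph b) \<inter> level k k = {}"
      using b by (auto simp: level_lower_iff height_aleph dest: class_ht)
    then show ?thesis by (auto simp: vertex_pair_def aleph_vertex_class)
  qed
  show *: "from_zero (labels k c) = from_zero (lex_labels b)" if c: "c \<in> vertex_class b" for c
  proof -
    obtain j where "c = rotate j b" using c by (auto simp: vertex_class_def)
    then show ?thesis
      using b rot_to_rotate[OF count_lex_labels[OF b(2,1)], of 0 j]
      by (simp add: labels_eq_lex_labels level_lower_iff lex_labels_rotate from_zero_eq)
  qed
  show "delta k (vertex_pair (vertex_class b)) = from_zero (lex_labels b)"
    unfolding delta_def V using * by (intro common_value_eq[OF vertex_class_self])
qed

theorem theorem8:
  fixes k :: nat
  assumes "1 < k"
  shows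
    "(\<forall>E\<in>edges (quotient_graph k). \<forall>e\<in>E. lexical_edge_color k e = quotient_color k E) \<and>
     one_factorization (quotient_graph k) {0..k} (quotient_color k) \<and>
     one_factorization (middle_graph k) {0..k} (lifted_color k) \<and>
     (\<forall>Q\<in>edges (folded_graph k). \<forall>E\<in>Q. quotient_color k E = collapsed_color k Q) \<and>
     one_factorization (folded_graph k) {0..k} (collapsed_color k) \<and>
     (\<forall>V\<in>verts (folded_graph k).
        (\<forall>b\<in>\<Union>V \<inter> level k k.
           (\<exists>!i. i < 2 * k + 1 \<and> labels k b ! i = Some 0) \<and>
           from_zero (labels k b) = delta k V) \<and>
        (\<exists>!\<alpha>. germ k \<alpha> \<and> from_zero (germ_string \<alpha>) = delta k V))"
proof (intro conjI ballI)
  show "lexical_edge_color k e = quotient_color k E" if "E \<in> edges (quotient_graph k)" "e \<in> E" for E e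
    using quotient_color_eq[OF that] by simp
  show "one_factorization (quotient_graph k) {0..k} (quotient_color k)"
    by (simp add: one_factorization_def quotient_color_le quotient_ex1)
  \<comment> \<open>The color of a class is that of any member, so lifting recovers the lexical
    coloring of M_k itself.\<close>
  have "lifted_color k e = lexical_edge_color k e" if "e \<in> edges (middle_graph k)" for e
    using quotient_color_eq[OF edge_class_in_quotient[OF that] edge_class_self] by (simp add: lifted_color_def)
  moreover have "ends (middle_graph k) e = e" for e by (simp add: middle_graph_def)
  ultimately show "one_factorization (middle_graph k) {0..k} (lifted_color k)"
    using middle_ex1 by (simp add: one_factorization_def lexical_edge_color_le cong: conj_cong)
  show "quotient_color k E = collapsed_color k Q" if "Q \<in> edges (folded_graph k)" "E \<in> Q" for Q E
    using that by (auto simp: edges_folded_graph collapsed_color_eq quotient_edge_aleph)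
  show "one_factorization (folded_graph k) {0..k} (collapsed_color k)"
    using folded_ex1 by (auto simp: one_factorization_def edges_folded_graph collapsed_color_eq quotient_color_le)
next
  fix V assume "V \<in> verts (folded_graph k)"
  then obtain b where b: "b \<in> level k k" and V: "V = vertex_pair (vertex_class b)"
    by (auto simp: folded_graph_def)
  show "\<exists>!\<alpha>. germ k \<alpha> \<and> from_zero (germ_string \<alpha>) = delta k V"
    using ex1_germ[OF assms] b delta_vertex_pair(3)[OF b] by (simp add: V level_lower_iff)
  fix c assume c: "c \<in> \<Union>V \<inter> level k k"
  then show "from_zero (labels k c) = delta k V"
    using delta_vertex_pair[OF b] by (auto simp: V)
  show "\<exists>!i. i < 2 * k + 1 \<and> labels k c ! i = Some 0"
    using c lex_labels_unique[of c k 0] by (simp add: labels_eq_lex_labels level_lower_iff)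
qed

end
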